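(* There is an increasing surjective computable function $f:[0,1]\to[0,1]$ which is not absolutely continuous, yet for every $\Pi^0_1$ set $A\subseteq[0,1]$ with $\lambda(A)=0$ it holds that $\lambda(f(A))=0$.
   Context: $\lambda$ is Lebesgue measure; a $\Pi^0_1$ set is an effectively closed set (complement is a union of a computably enumerable sequence of rational open intervals). Absolute continuity is the usual notion for real functions. *)

theory Defs
  imports "HOL-Analysis.Analysis" "HOL-Library.Countable" "HOL-Library.Nat_Bijection"
begin

section \<open>Computability relative to an oracle\<close>

text \<open>
  Programs for partial recursive functions of arbitrary arity, with a constructor \<open>Oracle\<close>
  for querying a function \<open>\<phi> :: nat \<Rightarrow> nat\<close>.  The relation \<open>computes \<phi> p xs y\<close> says that \<open>p\<close>,
  run on the arguments \<open>xs\<close> with oracle \<open>\<phi>\<close>, halts with output \<open>y\<close>.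
\<close>

datatype prog =
    Zero
  | Succ
  | Proj nat
  | Oracle
  | Comp prog "prog list"
  | PrimRec prog prog
  | Mu prog

inductive computes :: "(nat \<Rightarrow> nat) \<Rightarrow> prog \<Rightarrow> nat list \<Rightarrow> nat \<Rightarrow> bool"
  for \<phi> :: "nat \<Rightarrow> nat"
where
  computes_Zero: "computes \<phi> Zero xs 0"
| computes_Succ: "computes \<phi> Succ [x] (Suc x)"
| computes_Proj: "i < length xs \<Longrightarrow> computes \<phi> (Proj i) xs (xs ! i)"
| computes_Oracle: "computes \<phi> Oracle [x] (\<phi> x)"
| computes_Comp: "list_all2 (\<lambda>q y. computes \<phi> q xs y) qs ys \<Longrightarrow> computes \<phi> p ys z
    \<Longrightarrow> computes \<phi> (Comp p qs) xs z"
| computes_PrimRec_0: "computes \<phi> p xs y \<Longrightarrow> computes \<phi> (PrimRec p q) (0 # xs) y"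
| computes_PrimRec_Suc: "computes \<phi> (PrimRec p q) (n # xs) y \<Longrightarrow> computes \<phi> q (n # y # xs) z
    \<Longrightarrow> computes \<phi> (PrimRec p q) (Suc n # xs) z"
| computes_Mu: "computes \<phi> p (n # xs) 0 \<Longrightarrow> (\<And>m. m < n \<Longrightarrow> \<exists>k. computes \<phi> p (m # xs) (Suc k))
    \<Longrightarrow> computes \<phi> (Mu p) xs n"
monos list_all2_mono

text \<open>Computability without an oracle is computability with the constantly zero oracle.\<close>

definition computable_seq :: "(nat \<Rightarrow> nat) \<Rightarrow> bool" where
  "computable_seq g \<longleftrightarrow> (\<exists>p. \<forall>n. computes (\<lambda>_. 0) p [n] (g n))"


section \<open>Computable real functions and effectively closed sets\<close>

text \<open>Natural numbers code rationals via the library surjection \<^const>\<open>nat_to_rat_surj\<close>.\<close>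

definition rational_code :: "nat \<Rightarrow> real" where
  "rational_code n = of_rat (nat_to_rat_surj n)"

definition cauchy_name :: "(nat \<Rightarrow> nat) \<Rightarrow> real \<Rightarrow> bool" where
  "cauchy_name \<phi> x \<longleftrightarrow> (\<forall>n. \<bar>rational_code (\<phi> n) - x\<bar> \<le> 1 / 2 ^ n)"

text \<open>
  The usual (type-two) notion: a single oracle program turns every name of any \<open>x \<in> S\<close>
  into a name of \<open>f x\<close>.
\<close>

definition computable_on :: "real set \<Rightarrow> (real \<Rightarrow> real) \<Rightarrow> bool" where
  "computable_on S f \<longleftrightarrow>
     (\<exists>p. \<forall>x\<in>S. \<forall>\<phi>. cauchy_name \<phi> x \<longrightarrow>
        (\<exists>\<psi>. cauchy_name \<psi> (f x) \<and> (\<forall>n. computes \<phi> p [n] (\<psi> n))))"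

text \<open>
  Codes with left endpoint not below the right one denote the empty interval, so
  sequences of intervals with finite or empty union are covered as well.
\<close>

definition interval_code :: "nat \<Rightarrow> real set" where
  "interval_code n =
     (case prod_decode n of (a, b) \<Rightarrow> {rational_code a <..< rational_code b})"

definition Pi01_set :: "real set \<Rightarrow> bool" where
  "Pi01_set A \<longleftrightarrow> (\<exists>g. computable_seq g \<and> - A = (\<Union>n. interval_code (g n)))"


section \<open>Absolute continuity\<close>

text \<open>
  A finite set of pairs \<open>(a, b)\<close> with \<open>a < b\<close> represents a finite family of non-overlapping
  subintervals of \<open>S\<close>.  (The library constant \<^const>\<open>absolutely_continuous\<close> is about measures.)
\<close>

definition absolutely_continuous_fun_on :: "real set \<Rightarrow> (real \<Rightarrow> real) \<Rightarrow> bool" where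
  "absolutely_continuous_fun_on S f \<longleftrightarrow>
     (\<forall>\<epsilon>>0. \<exists>\<delta>>0. \<forall>P :: (real \<times> real) set.
        finite P \<and> (\<forall>(a, b)\<in>P. a < b \<and> {a..b} \<subseteq> S) \<and>
        disjoint_family_on (\<lambda>(a, b). {a<..<b}) P \<and>
        (\<Sum>(a, b)\<in>P. b - a) < \<delta>
        \<longrightarrow> (\<Sum>(a, b)\<in>P. \<bar>f b - f a\<bar>) < \<epsilon>)"

end

(*
  Let f be the distribution function of a measure mu obtained as the limit of step densities on finer
  and finer grids.  Each stage redistributes mass inside the cells of the previous grid only.
  Normally almost all mass of a cell is moved to a small portion of it; doing this at every stage to at
  least half of the mass prevents absolute continuity.

  For the i-th effectively closed set A, split the unit interval into pieces of mass at most
  1 / 2^(i+2) and treat them one after the other: the current piece J is locked, meaning that its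
  density is left unchanged, until the part of J not yet enumerated into the complement of A has
  relative mass at most 1 / 2^i.  This last condition is never lost again.  If A is null, the bounded
  density on J makes it happen eventually, so all pieces get treated and mu(A) <= 1 / 2^i; with
  infinitely many i for every A this gives mu(A) = 0.  If A is not null, i may lock a piece forever.
  In any case at most a mass of sum_i 1 / 2^(i+2) = 1/2 is locked at any stage, and the requirements
  do not interfere with each other.
*)

theory Submission
  imports Defs
begin

text \<open>By the Banach-Zarecki theorem, an increasing continuous function that is not absolutely
  continuous maps some null set to a set that is not null. The argument must therefore use that the
  null sets considered are effectively closed. This supplies a computable decreasing sequence of
  finite unions of cells whose total lengths tend to 0. Small length by itself says nothing about
  mass while the density may still grow, hence the locking. No stage reveals whether a set is null,
  so a requirement may wait forever; treating one small piece at a time limits the price of such a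
  wait. The sets are indexed by all machine codes, and running each machine for a bounded number of
  steps keeps every stage finite and computable.\<close>

section \<open>Computable functions on natural numbers\<close>

text \<open>The program must be correct under every oracle, since
  \<open>approx_value_program\<close> finally runs it beside a genuine query to an arbitrary
  name.\<close>

definition recf :: "nat \<Rightarrow> (nat list \<Rightarrow> nat) \<Rightarrow> bool" where
  "recf n F \<longleftrightarrow> (\<exists>p. \<forall>\<phi> xs. length xs = n \<longrightarrow> computes \<phi> p xs (F xs))"

lemma recf_cong: "recf n F \<Longrightarrow> (\<And>xs. length xs = n \<Longrightarrow> F xs = G xs) \<Longrightarrow> recf n G"
  unfolding recf_def by (elim exE, intro exI) simp

lemma recf_nth: "i < n \<Longrightarrow> recf n (\<lambda>xs. xs ! i)"
  unfolding recf_def by (intro exI[of _ "Proj i"]) (auto intro: computes_Proj)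

lemma recf_comp1:
  assumes "recf 1 (\<lambda>ys. h (ys ! 0))" "recf n F"
  shows "recf n (\<lambda>xs. h (F xs))"
proof -
  obtain p where p: "\<And>\<phi> xs. length xs = 1 \<Longrightarrow> computes \<phi> p xs (h (xs ! 0))"
    using assms(1) unfolding recf_def by auto
  obtain q where q: "\<And>\<phi> xs. length xs = n \<Longrightarrow> computes \<phi> q xs (F xs)"
    using assms(2) unfolding recf_def by auto
  have "computes \<phi> (Comp p [q]) xs (h (F xs))" if "length xs = n" for \<phi> xs
    using p[of "[F xs]" \<phi>] q[OF that, of \<phi>]
    by (intro computes_Comp[where ys="[F xs]"]) auto
  then show ?thesis unfolding recf_def by blast
qed

lemma recf_comp2:
  assumes "recf 2 (\<lambda>ys. h (ys ! 0) (ys ! 1))" "recf n F" "recf n G"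
  shows "recf n (\<lambda>xs. h (F xs) (G xs))"
proof -
  obtain p where p: "\<And>\<phi> xs. length xs = 2 \<Longrightarrow> computes \<phi> p xs (h (xs ! 0) (xs ! 1))"
    using assms(1) unfolding recf_def by auto
  obtain q where q: "\<And>\<phi> xs. length xs = n \<Longrightarrow> computes \<phi> q xs (F xs)"
    using assms(2) unfolding recf_def by auto
  obtain r where r: "\<And>\<phi> xs. length xs = n \<Longrightarrow> computes \<phi> r xs (G xs)"
    using assms(3) unfolding recf_def by auto
  have "computes \<phi> (Comp p [q, r]) xs (h (F xs) (G xs))" if "length xs = n" for \<phi> xs
    using p[of "[F xs, G xs]" \<phi>] q[OF that, of \<phi>] r[OF that, of \<phi>]
    by (intro computes_Comp[where ys="[F xs, G xs]"]) auto
  then show ?thesis unfolding recf_def by blast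
qed

lemma recf_Suc: "recf n F \<Longrightarrow> recf n (\<lambda>xs. Suc (F xs))"
proof (rule recf_comp1[where h=Suc])
  have "computes \<phi> Succ xs (Suc (xs ! 0))" if "length xs = 1" for \<phi> xs
    using that by (cases xs) (auto intro: computes_Succ)
  then show "recf 1 (\<lambda>ys. Suc (ys ! 0))" unfolding recf_def by blast
qed

lemma recf_const: "recf n (\<lambda>_. c)"
proof (induction c)
  case 0
  show ?case unfolding recf_def by (intro exI[of _ Zero]) (auto intro: computes_Zero)
qed (rule recf_Suc)

lemma recf_rec:
  assumes "recf n A" "recf (Suc (Suc n)) B"
  shows "recf (Suc n) (\<lambda>xs. rec_nat (A (tl xs)) (\<lambda>k r. B (k # r # tl xs)) (hd xs))"
proof -
  obtain p where p: "\<And>\<phi> xs. length xs = n \<Longrightarrow> computes \<phi> p xs (A xs)"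
    using assms(1) unfolding recf_def by auto
  obtain q where q: "\<And>\<phi> xs. length xs = Suc (Suc n) \<Longrightarrow> computes \<phi> q xs (B xs)"
    using assms(2) unfolding recf_def by auto
  have "computes \<phi> (PrimRec p q) (m # xs) (rec_nat (A xs) (\<lambda>k r. B (k # r # xs)) m)"
    if "length xs = n" for \<phi> m xs
    by (induction m) (auto intro!: computes_PrimRec_0 computes_PrimRec_Suc p q simp: that)
  then have "computes \<phi> (PrimRec p q) xs (rec_nat (A (tl xs)) (\<lambda>k r. B (k # r # tl xs)) (hd xs))"
    if "length xs = Suc n" for \<phi> xs
    using that by (cases xs) auto
  then show ?thesis unfolding recf_def by blast
qed

lemma recf_rec1:
  assumes "recf 2 (\<lambda>ys. b (ys ! 0) (ys ! 1))" "recf n F"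
  shows "recf n (\<lambda>xs. rec_nat a b (F xs))"
proof (rule recf_comp1[OF _ assms(2)])
  have "recf (Suc 0) (\<lambda>xs. rec_nat a (\<lambda>k r. (\<lambda>ys. b (ys ! 0) (ys ! 1)) (k # r # tl xs)) (hd xs))"
    by (rule recf_rec[OF recf_const]) (use assms(1) in \<open>simp add: numeral_2_eq_2\<close>)
  then show "recf 1 (\<lambda>ys. rec_nat a b (ys ! 0))"
    unfolding One_nat_def by (rule recf_cong) (auto simp: length_Suc_conv)
qed

lemma recf_rec2:
  assumes "recf 1 (\<lambda>ys. a (ys ! 0))" "recf 3 (\<lambda>ys. b (ys ! 2) (ys ! 0) (ys ! 1))"
    "recf n F" "recf n G"
  shows "recf n (\<lambda>xs. rec_nat (a (G xs)) (b (G xs)) (F xs))"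
proof (rule recf_comp2[OF _ assms(3,4)])
  have "recf (Suc 1) (\<lambda>xs. rec_nat ((\<lambda>ys. a (ys ! 0)) (tl xs))
      (\<lambda>k r. (\<lambda>ys. b (ys ! 2) (ys ! 0) (ys ! 1)) (k # r # tl xs)) (hd xs))"
    by (rule recf_rec[OF assms(1)]) (use assms(2) in \<open>simp add: numeral_3_eq_3\<close>)
  then have "recf 2 (\<lambda>xs. rec_nat ((\<lambda>ys. a (ys ! 0)) (tl xs))
      (\<lambda>k r. (\<lambda>ys. b (ys ! 2) (ys ! 0) (ys ! 1)) (k # r # tl xs)) (hd xs))"
    by (simp add: numeral_2_eq_2)
  then show "recf 2 (\<lambda>ys. rec_nat (a (ys ! 1)) (b (ys ! 1)) (ys ! 0))"
    by (rule recf_cong) (auto simp: length_Suc_conv numeral_2_eq_2)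
qed

lemma recf_add: "recf n F \<Longrightarrow> recf n G \<Longrightarrow> recf n (\<lambda>xs. F xs + G xs)"
proof -
  assume "recf n F" "recf n G"
  then have "recf n (\<lambda>xs. rec_nat (G xs) (\<lambda>k r. Suc r) (F xs))"
    by (intro recf_rec2 recf_nth recf_Suc) auto
  moreover have "rec_nat g (\<lambda>k r. Suc r) f = f + g" for f g :: nat
    by (induction f) auto
  ultimately show ?thesis by simp
qed

lemma recf_mult: "recf n F \<Longrightarrow> recf n G \<Longrightarrow> recf n (\<lambda>xs. F xs * G xs)"
proof -
  assume "recf n F" "recf n G"
  then have "recf n (\<lambda>xs. rec_nat 0 (\<lambda>k r. G xs + r) (F xs))"
    by (intro recf_rec2[where a="\<lambda>_. 0"] recf_nth recf_add recf_const) auto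
  moreover have "rec_nat 0 (\<lambda>k r. g + r) f = f * g" for f g :: nat
    by (induction f) auto
  ultimately show ?thesis by simp
qed

lemma recf_diff: "recf n F \<Longrightarrow> recf n G \<Longrightarrow> recf n (\<lambda>xs. F xs - G xs)"
proof -
  have pred: "recf n (\<lambda>xs. F xs - 1)" if "recf n F" for n F
  proof -
    have "recf n (\<lambda>xs. rec_nat 0 (\<lambda>k r. k) (F xs))"
      by (intro recf_rec1 recf_nth that) auto
    moreover have "rec_nat 0 (\<lambda>k r. k) f = f - 1" for f :: nat
      by (cases f) auto
    ultimately show ?thesis by simp
  qed
  assume "recf n F" "recf n G"
  then have "recf n (\<lambda>xs. rec_nat (F xs) (\<lambda>k r. r - 1) (G xs))"
    by (intro recf_rec2 recf_nth pred) auto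
  moreover have "rec_nat g (\<lambda>k r. r - 1) f = g - f" for f g :: nat
    by (induction f) auto
  ultimately show ?thesis by simp
qed

lemma recf_if_le:
  assumes "recf n F" "recf n G" "recf n A" "recf n B"
  shows "recf n (\<lambda>xs. if F xs \<le> G xs then A xs else B xs)"
proof -
  \<comment> \<open>Truncated subtraction makes \<open>1 - (F xs - G xs)\<close> the 0-1 indicator
    of \<open>F xs \<le> G xs\<close>.\<close>
  have "recf n (\<lambda>xs. (1 - (F xs - G xs)) * A xs + (1 - (1 - (F xs - G xs))) * B xs)"
    by (intro recf_add recf_mult recf_diff recf_const assms)
  then show ?thesis by (rule recf_cong) auto
qed

lemma recf_triangle: "recf n F \<Longrightarrow> recf n (\<lambda>xs. triangle (F xs))"
proof -
  assume "recf n F"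
  then have "recf n (\<lambda>xs. rec_nat 0 (\<lambda>k r. r + Suc k) (F xs))"
    by (intro recf_rec1 recf_nth recf_add recf_Suc) auto
  moreover have "rec_nat 0 (\<lambda>k r. r + Suc k) f = triangle f" for f :: nat
    by (induction f) auto
  ultimately show ?thesis by simp
qed

subsection \<open>Pairing\<close>

definition pr :: "nat \<Rightarrow> nat \<Rightarrow> nat" where "pr x y = prod_encode (x, y)"
definition p1 :: "nat \<Rightarrow> nat" where "p1 z = fst (prod_decode z)"
definition p2 :: "nat \<Rightarrow> nat" where "p2 z = snd (prod_decode z)"

lemma p1_pr [simp]: "p1 (pr x y) = x" and p2_pr [simp]: "p2 (pr x y) = y"
  by (simp_all add: p1_def p2_def pr_def)

lemma pr_p1_p2 [simp]: "pr (p1 z) (p2 z) = z"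
  by (simp add: p1_def p2_def pr_def)

lemma recf_pr: "recf n F \<Longrightarrow> recf n G \<Longrightarrow> recf n (\<lambda>xs. pr (F xs) (G xs))"
  unfolding pr_def prod_encode_def prod.case by (intro recf_add recf_triangle)

text \<open>The largest r with \<open>triangle r \<le> z\<close>. As
  \<open>prod_encode (x, y) = triangle (x + y) + x\<close>, it recovers \<open>x + y\<close> from a
  code, so pairs are decoded by primitive recursion, without a search.\<close>

definition triangle_root :: "nat \<Rightarrow> nat" where
  "triangle_root = rec_nat 0 (\<lambda>k r. if triangle (Suc r) \<le> Suc k then Suc r else r)"

lemma triangle_root_bounds:
  "triangle (triangle_root z) \<le> z \<and> z < triangle (Suc (triangle_root z))"
  by (induction z) (auto simp: triangle_root_def)

lemma triangle_mono: "a \<le> b \<Longrightarrow> triangle a \<le> triangle b"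
  by (induction rule: dec_induct) auto

lemma triangle_root_pr: "triangle_root (pr x y) = x + y"
proof -
  let ?t = "triangle_root (pr x y)"
  have "triangle (x + y) \<le> pr x y" "pr x y < triangle (Suc (x + y))"
    by (auto simp: pr_def prod_encode_def)
  then have "triangle ?t < triangle (Suc (x + y))" "triangle (x + y) < triangle (Suc ?t)"
    using triangle_root_bounds[of "pr x y"] by linarith+
  then have "?t < Suc (x + y)" "x + y < Suc ?t"
    using triangle_mono by (meson leD leI)+
  then show ?thesis by simp
qed

lemma p1_eq: "p1 z = z - triangle (triangle_root z)"
proof -
  have "z = pr (p1 z) (p2 z)" by simp
  moreover have "x = pr x y - triangle (triangle_root (pr x y))" for x y
    by (simp add: triangle_root_pr) (simp add: pr_def prod_encode_def)
  ultimately show ?thesis by metis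
qed

lemma p2_eq: "p2 z = triangle_root z - p1 z"
  using triangle_root_pr[of "p1 z" "p2 z"] by simp

lemma recf_triangle_root: "recf n F \<Longrightarrow> recf n (\<lambda>xs. triangle_root (F xs))"
  unfolding triangle_root_def
  by (intro recf_rec1 recf_if_le recf_triangle recf_Suc recf_nth) auto

lemma recf_p1: "recf n F \<Longrightarrow> recf n (\<lambda>xs. p1 (F xs))"
  unfolding p1_eq by (intro recf_diff recf_triangle recf_triangle_root)

lemma recf_p2: "recf n F \<Longrightarrow> recf n (\<lambda>xs. p2 (F xs))"
  unfolding p2_eq by (intro recf_diff recf_p1 recf_triangle_root)

subsection \<open>A calculus of unary computable functions\<close>

text \<open>Further arguments are packed with \<open>pr\<close>: a body \<open>h x k\<close> under a
  bounded operator is handled as the unary function \<open>\<lambda>z. h (p1 z) (p2 z)\<close>.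
  Computability then follows by syntax-directed rules.\<close>

definition cmp :: "(nat \<Rightarrow> nat) \<Rightarrow> bool" where
  "cmp f \<longleftrightarrow> recf 1 (\<lambda>xs. f (xs ! 0))"

definition cmpP :: "(nat \<Rightarrow> bool) \<Rightarrow> bool" where
  "cmpP P \<longleftrightarrow> cmp (\<lambda>x. of_bool (P x))"

named_theorems cmp_intros

lemma cmp_id [cmp_intros]: "cmp (\<lambda>x. x)"
  unfolding cmp_def by (rule recf_nth) simp

lemma cmp_const [cmp_intros]: "cmp (\<lambda>_. c)"
  unfolding cmp_def by (rule recf_const)

lemma cmp_comp: "cmp h \<Longrightarrow> cmp f \<Longrightarrow> cmp (\<lambda>x. h (f x))"
  unfolding cmp_def by (rule recf_comp1)

lemma cmp_Suc [cmp_intros]: "cmp f \<Longrightarrow> cmp (\<lambda>x. Suc (f x))"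
  and cmp_add [cmp_intros]: "cmp f \<Longrightarrow> cmp g \<Longrightarrow> cmp (\<lambda>x. f x + g x)"
  and cmp_mult [cmp_intros]: "cmp f \<Longrightarrow> cmp g \<Longrightarrow> cmp (\<lambda>x. f x * g x)"
  and cmp_diff [cmp_intros]: "cmp f \<Longrightarrow> cmp g \<Longrightarrow> cmp (\<lambda>x. f x - g x)"
  and cmp_triangle [cmp_intros]: "cmp f \<Longrightarrow> cmp (\<lambda>x. triangle (f x))"
  and cmp_pr [cmp_intros]: "cmp f \<Longrightarrow> cmp g \<Longrightarrow> cmp (\<lambda>x. pr (f x) (g x))"
  and cmp_p1 [cmp_intros]: "cmp f \<Longrightarrow> cmp (\<lambda>x. p1 (f x))"
  and cmp_p2 [cmp_intros]: "cmp f \<Longrightarrow> cmp (\<lambda>x. p2 (f x))"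
  unfolding cmp_def
  by (simp_all add: recf_Suc recf_add recf_mult recf_diff recf_triangle recf_pr recf_p1 recf_p2)

lemma cmp_cong: "cmp f \<Longrightarrow> (\<And>x. f x = g x) \<Longrightarrow> cmp g"
  by (simp add: cmp_def)

lemma cmpP_le [cmp_intros]: "cmp f \<Longrightarrow> cmp g \<Longrightarrow> cmpP (\<lambda>x. f x \<le> g x)"
  unfolding cmpP_def
  by (rule cmp_cong[where f="\<lambda>x. 1 - (f x - g x)"]) (auto intro!: cmp_intros)

lemma cmpP_not [cmp_intros]: "cmpP P \<Longrightarrow> cmpP (\<lambda>x. \<not> P x)"
  unfolding cmpP_def
  by (rule cmp_cong[where f="\<lambda>x. 1 - of_bool (P x)"]) (auto intro!: cmp_intros)

lemma cmpP_conj [cmp_intros]: "cmpP P \<Longrightarrow> cmpP Q \<Longrightarrow> cmpP (\<lambda>x. P x \<and> Q x)"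
  unfolding cmpP_def
  by (rule cmp_cong[where f="\<lambda>x. of_bool (P x) * of_bool (Q x)"]) (auto intro!: cmp_mult)

lemma cmpP_cong: "cmpP P \<Longrightarrow> (\<And>x. P x = Q x) \<Longrightarrow> cmpP Q"
  by (simp add: cmpP_def)

lemma cmpP_disj [cmp_intros]: "cmpP P \<Longrightarrow> cmpP Q \<Longrightarrow> cmpP (\<lambda>x. P x \<or> Q x)"
  by (rule cmpP_cong[where P="\<lambda>x. \<not> (\<not> P x \<and> \<not> Q x)"], intro cmp_intros) auto

lemma cmpP_less [cmp_intros]: "cmp f \<Longrightarrow> cmp g \<Longrightarrow> cmpP (\<lambda>x. f x < g x)"
  by (rule cmpP_cong[where P="\<lambda>x. \<not> g x \<le> f x"], intro cmp_intros) auto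

lemma cmpP_eq [cmp_intros]: "cmp f \<Longrightarrow> cmp g \<Longrightarrow> cmpP (\<lambda>x. f x = g x)"
  by (rule cmpP_cong[where P="\<lambda>x. g x \<le> f x \<and> f x \<le> g x"], intro cmp_intros) auto

lemma cmpP_eq_bool [cmp_intros]: "cmpP P \<Longrightarrow> cmpP Q \<Longrightarrow> cmpP (\<lambda>x. P x = Q x)"
  by (rule cmpP_cong[where P="\<lambda>x. (P x \<and> Q x) \<or> (\<not> P x \<and> \<not> Q x)"], intro cmp_intros) auto

lemma cmp_if [cmp_intros]:
  assumes "cmpP P" "cmp f" "cmp g"
  shows "cmp (\<lambda>x. if P x then f x else g x)"
  by (rule cmp_cong[where f="\<lambda>x. of_bool (P x) * f x + (1 - of_bool (P x)) * g x"])
    (use assms in \<open>auto intro!: cmp_add cmp_mult cmp_diff cmp_const simp: cmpP_def\<close>)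

lemma cmp_rec [cmp_intros]:
  assumes "cmp a" "cmp (\<lambda>z. b (p1 z) (p1 (p2 z)) (p2 (p2 z)))" "cmp c"
  shows "cmp (\<lambda>x. rec_nat (a x) (b x) (c x))"
proof -
  let ?H = "\<lambda>z. b (p1 z) (p1 (p2 z)) (p2 (p2 z))"
  have "recf 3 (\<lambda>ys. ?H (pr (ys ! 2) (pr (ys ! 0) (ys ! 1))))"
    by (rule recf_comp1) (use assms(2) in \<open>auto simp: cmp_def intro!: recf_pr recf_nth\<close>)
  then show ?thesis
    unfolding cmp_def using assms(1,3)
    by (intro recf_rec2[where F="\<lambda>xs. c (xs ! 0)" and G="\<lambda>xs. xs ! 0"] recf_nth)
      (auto simp: cmp_def)
qed

lemma cmp_funpow [cmp_intros]:
  assumes "cmp (\<lambda>z. h (p1 z) (p2 z))" "cmp a" "cmp c"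
  shows "cmp (\<lambda>x. (h x ^^ c x) (a x))"
proof -
  have "cmp (\<lambda>z. (\<lambda>z. h (p1 z) (p2 z)) (pr (p1 z) (p2 (p2 z))))"
    by (rule cmp_comp[OF assms(1)]) (intro cmp_intros)
  then have "cmp (\<lambda>x. rec_nat (a x) (\<lambda>_. h x) (c x))"
    by (intro cmp_rec assms) simp
  moreover have "rec_nat a (\<lambda>_. h) n = (h ^^ n) a" for a n and h :: "nat \<Rightarrow> nat"
    by (induction n) auto
  ultimately show ?thesis by simp
qed

lemma cmp_sum [cmp_intros]:
  assumes "cmp (\<lambda>z. g (p1 z) (p2 z))" "cmp c"
  shows "cmp (\<lambda>x. \<Sum>k<c x. g x k)"
proof -
  have "cmp (\<lambda>z. (\<lambda>z. g (p1 z) (p2 z)) (pr (p1 z) (p1 (p2 z))))"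
    by (rule cmp_comp[OF assms(1)]) (intro cmp_intros)
  then have "cmp (\<lambda>x. rec_nat 0 (\<lambda>k r. r + g x k) (c x))"
    by (intro cmp_rec assms cmp_intros) simp
  moreover have "rec_nat 0 (\<lambda>k r. r + h k) n = (\<Sum>k<n. h k)" for n :: nat and h :: "nat \<Rightarrow> nat"
    by (induction n) auto
  ultimately show ?thesis by simp
qed

lemma cmpP_ex [cmp_intros]:
  assumes "cmpP (\<lambda>z. P (p1 z) (p2 z))" "cmp c"
  shows "cmpP (\<lambda>x. \<exists>k<c x. P x k)"
proof -
  have "cmpP (\<lambda>x. 0 < (\<Sum>k<c x. of_bool (P x k) :: nat))"
    using assms by (intro cmp_intros) (simp_all add: cmpP_def)
  then show ?thesis by (rule cmpP_cong) (auto simp: card_gt_0_iff)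
qed

lemma cmpP_all [cmp_intros]:
  assumes "cmpP (\<lambda>z. P (p1 z) (p2 z))" "cmp c"
  shows "cmpP (\<lambda>x. \<forall>k<c x. P x k)"
  by (rule cmpP_cong[where P="\<lambda>x. \<not> (\<exists>k<c x. \<not> P x k)"], intro cmp_intros assms) auto

lemma cmp_power [cmp_intros]: "cmp f \<Longrightarrow> cmp g \<Longrightarrow> cmp (\<lambda>x. f x ^ g x)"
proof -
  assume f: "cmp f" and g: "cmp g"
  have "cmp (\<lambda>z. f (p1 z))" by (rule cmp_comp[OF f]) (intro cmp_intros)
  then have "cmp (\<lambda>x. ((\<lambda>r. f x * r) ^^ g x) 1)"
    by (intro cmp_intros g)
  moreover have "((\<lambda>r. a * r) ^^ n) 1 = a ^ n" for a n :: nat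
    by (induction n) auto
  ultimately show ?thesis by simp
qed

text \<open>The quotient grows by one exactly when the dividend reaches the next multiple of the
  divisor. The guard \<open>0 < g x\<close> yields the HOL value 0 for division by 0.\<close>

lemma cmp_div [cmp_intros]: "cmp f \<Longrightarrow> cmp g \<Longrightarrow> cmp (\<lambda>x. f x div g x)"
proof -
  assume f: "cmp f" and g: "cmp g"
  have g': "cmp (\<lambda>z. g (p1 z))" by (rule cmp_comp[OF g]) (intro cmp_intros)
  have "cmp (\<lambda>x. rec_nat 0 (\<lambda>k r. if 0 < g x \<and> Suc r * g x \<le> Suc k then Suc r else r) (f x))"
    by (intro cmp_intros f g')
  moreover have "rec_nat 0 (\<lambda>k r. if 0 < d \<and> Suc r * d \<le> Suc k then Suc r else r) n = n div d"
    (is "?R n = _") for d n :: nat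
  proof (induction n)
    case (Suc n)
    have step: "?R (Suc n) = (if 0 < d \<and> Suc (?R n) * d \<le> Suc n then Suc (?R n) else ?R n)"
      by (subst old.nat.rec(2)) (rule refl)
    show ?case
    proof (cases "0 < d \<and> Suc (n div d) * d \<le> Suc n")
      case True
      then have "Suc (n div d) \<le> Suc n div d"
        by (metis less_eq_div_iff_mult_less_eq)
      moreover have "Suc n div d \<le> Suc (n div d)" by (simp add: div_Suc)
      ultimately show ?thesis using True unfolding step Suc.IH by simp
    next
      case False
      then have "Suc n div d = n div d" if "0 < d"
        using that div_le_mono[of n "Suc n" d] div_less_iff_less_mult[of d "Suc n" "Suc (n div d)"]
        by linarith
      then have "Suc n div d = n div d" by (cases "d = 0") auto
      then show ?thesis using False unfolding step Suc.IH by simp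
    qed
  qed simp
  ultimately show ?thesis by simp
qed

lemma cmp_mod [cmp_intros]: "cmp f \<Longrightarrow> cmp g \<Longrightarrow> cmp (\<lambda>x. f x mod g x)"
  unfolding minus_div_mult_eq_mod[symmetric] by (intro cmp_intros)

lemma cmpP_even [cmp_intros]: "cmp f \<Longrightarrow> cmpP (\<lambda>x. even (f x))"
  unfolding even_iff_mod_2_eq_zero by (intro cmp_intros)

subsection \<open>Finite tables coded as numbers\<close>

text \<open>Entries are stacked with the last one outermost, and the code does not record its
  length; hence \<open>look\<close> takes n and peels off \<open>n - Suc k\<close> entries.\<close>

definition tab :: "nat \<Rightarrow> (nat \<Rightarrow> nat) \<Rightarrow> nat" where
  "tab n g = rec_nat 0 (\<lambda>k acc. pr (g k) acc) n"

definition look :: "nat \<Rightarrow> nat \<Rightarrow> nat \<Rightarrow> nat" where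
  "look n c k = p1 ((p2 ^^ (n - Suc k)) c)"

lemma look_tab:
  assumes "k < n"
  shows "look n (tab n g) k = g k"
proof -
  have "(p2 ^^ j) (tab (j + m) g) = tab m g" for j m
    by (induction j) (simp_all add: tab_def funpow_Suc_right del: funpow.simps)
  from this[of "n - Suc k" "Suc k"] have "(p2 ^^ (n - Suc k)) (tab n g) = tab (Suc k) g"
    using assms by simp
  then show ?thesis by (simp add: look_def tab_def)
qed

lemma cmp_tab [cmp_intros]:
  assumes "cmp n" "cmp (\<lambda>z. g (p1 z) (p2 z))"
  shows "cmp (\<lambda>x. tab (n x) (g x))"
proof -
  have "cmp (\<lambda>z. (\<lambda>z. g (p1 z) (p2 z)) (pr (p1 z) (p1 (p2 z))))"
    by (rule cmp_comp[OF assms(2)]) (intro cmp_intros)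
  then show ?thesis unfolding tab_def by (intro cmp_intros assms) simp
qed

lemma cmp_look [cmp_intros]:
  "cmp n \<Longrightarrow> cmp c \<Longrightarrow> cmp k \<Longrightarrow> cmp (\<lambda>x. look (n x) (c x) (k x))"
  unfolding look_def by (intro cmp_intros)

section \<open>A universal enumeration of the computable sequences\<close>

text \<open>
  A machine state \<open>pr K v\<close> consists of a stack \<open>K\<close> of instructions and a value \<open>v\<close>.  An
  instruction is a pair of an opcode and an argument; opcodes 6, 7, 9 and 11 are the continuations
  that remember what is left to do of a pairing, a recursion and an unbounded search.
\<close>

definition push :: "nat \<Rightarrow> nat \<Rightarrow> nat" where "push i K = Suc (pr i K)"

definition act :: "nat \<Rightarrow> nat \<Rightarrow> nat \<Rightarrow> nat \<Rightarrow> nat" where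
  "act t a K v =
    (if t = 0 then pr K 0
     else if t = 1 then pr K (Suc v)
     else if t = 2 then pr K (p1 v)
     else if t = 3 then pr K (p2 v)
     else if t = 4 then pr (push (p2 a) (push (p1 a) K)) v
     else if t = 5 then pr (push (p1 a) (push (pr 6 (pr (p2 a) v)) K)) v
     else if t = 6 then pr (push (p1 a) (push (pr 7 v) K)) (p2 a)
     else if t = 7 then pr K (pr a v)
     else if t = 8 then
       (if p1 v = 0 then pr (push (p1 a) K) (p2 v)
        else pr (push (pr 8 a) (push (pr 9 (pr (p2 a) (pr (p1 v - 1) (p2 v)))) K))
               (pr (p1 v - 1) (p2 v)))
     else if t = 9 then pr (push (p1 a) K) (pr (p1 (p2 a)) (pr v (p2 (p2 a))))
     else if t = 10 then pr (push a (push (pr 11 (pr a (pr 0 v))) K)) (pr 0 v)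
     else (if v = 0 then pr K (p1 (p2 a))
           else pr (push (p1 a) (push (pr 11 (pr (p1 a) (pr (Suc (p1 (p2 a))) (p2 (p2 a))))) K))
                  (pr (Suc (p1 (p2 a))) (p2 (p2 a)))))"

definition mstep :: "nat \<Rightarrow> nat" where
  "mstep s = (if p1 s = 0 then s
     else act (p1 (p1 (p1 s - 1))) (p2 (p1 (p1 s - 1))) (p2 (p1 s - 1)) (p2 s))"

lemma mstep_halt [simp]: "mstep (pr 0 v) = pr 0 v"
  by (simp add: mstep_def)

lemma mstep_push [simp]: "mstep (pr (push (pr t a) K) v) = act t a K v"
  by (simp add: mstep_def push_def)

definition reach :: "nat \<Rightarrow> nat \<Rightarrow> bool" where
  "reach s t \<longleftrightarrow> (\<exists>n. (mstep ^^ n) s = t)"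

lemma reach_refl: "reach s s"
  unfolding reach_def by (rule exI[of _ 0]) simp

lemma reach_trans: "reach s t \<Longrightarrow> reach t u \<Longrightarrow> reach s u"
  unfolding reach_def by (metis comp_apply funpow_add)

lemma reach_mstep: "reach (mstep s) t \<Longrightarrow> reach s t"
  unfolding reach_def by (metis comp_apply funpow_Suc_right)

lemma reach_push: "reach (act t a K v) u \<Longrightarrow> reach (pr (push (pr t a) K) v) u"
  by (rule reach_mstep) simp

text \<open>K is the rest of the stack: an instruction has to leave everything below it untouched,
  which makes the rules for the constructors compose.\<close>

definition runs :: "nat \<Rightarrow> nat \<Rightarrow> nat \<Rightarrow> bool" where
  "runs c x y \<longleftrightarrow> (\<forall>K. reach (pr (push c K) x) (pr K y))"

definition CZero :: nat where "CZero = pr 0 0"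
definition CSucc :: nat where "CSucc = pr 1 0"
definition CFst :: nat where "CFst = pr 2 0"
definition CSnd :: nat where "CSnd = pr 3 0"
definition CComp :: "nat \<Rightarrow> nat \<Rightarrow> nat" where "CComp f g = pr 4 (pr f g)"
definition CPair :: "nat \<Rightarrow> nat \<Rightarrow> nat" where "CPair f g = pr 5 (pr f g)"
definition CRec :: "nat \<Rightarrow> nat \<Rightarrow> nat" where "CRec f g = pr 8 (pr f g)"
definition CMu :: "nat \<Rightarrow> nat" where "CMu f = pr 10 f"

lemma runs_Zero: "runs CZero x 0"
  and runs_Succ: "runs CSucc x (Suc x)"
  and runs_Fst: "runs CFst x (p1 x)"
  and runs_Snd: "runs CSnd x (p2 x)"
  by (auto simp: runs_def CZero_def CSucc_def CFst_def CSnd_def act_def intro!: reach_push reach_refl)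

lemma runs_Comp: "runs g x y \<Longrightarrow> runs f y z \<Longrightarrow> runs (CComp f g) x z"
  unfolding runs_def CComp_def by (auto intro!: reach_push simp: act_def) (blast intro: reach_trans)

lemma runs_Pair:
  assumes "runs f x y" "runs g x z"
  shows "runs (CPair f g) x (pr y z)"
  unfolding runs_def CPair_def
proof
  fix K
  have "reach (pr (push (pr 7 y) K) z) (pr K (pr y z))"
    by (rule reach_push) (simp add: act_def reach_refl)
  then have "reach (pr (push g (push (pr 7 y) K)) x) (pr K (pr y z))"
    using assms(2) reach_trans unfolding runs_def by blast
  then have "reach (pr (push (pr 6 (pr g x)) K) y) (pr K (pr y z))"
    by (intro reach_push) (simp add: act_def)
  then have "reach (pr (push f (push (pr 6 (pr g x)) K)) x) (pr K (pr y z))"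
    using assms(1) reach_trans unfolding runs_def by blast
  then show "reach (pr (push (pr 5 (pr f g)) K) x) (pr K (pr y z))"
    by (intro reach_push) (simp add: act_def)
qed

lemma runs_Rec_0: "runs f x y \<Longrightarrow> runs (CRec f g) (pr 0 x) y"
  unfolding runs_def CRec_def by (auto intro!: reach_push simp: act_def)

lemma runs_Rec_Suc:
  assumes "runs (CRec f g) (pr n x) y" "runs g (pr n (pr y x)) z"
  shows "runs (CRec f g) (pr (Suc n) x) z"
  unfolding runs_def
proof
  fix K
  let ?K = "push (pr 9 (pr g (pr n x))) K"
  have "reach (pr ?K y) (pr K z)"
    using assms(2) by (intro reach_push) (simp add: act_def runs_def)
  then have "reach (pr (push (CRec f g) ?K) (pr n x)) (pr K z)"
    using assms(1) reach_trans unfolding runs_def by blast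
  then show "reach (pr (push (CRec f g) K) (pr (Suc n) x)) (pr K z)"
    unfolding CRec_def by (intro reach_push) (simp add: act_def)
qed

lemma runs_Mu:
  assumes "runs f (pr n x) 0" "\<And>m. m < n \<Longrightarrow> \<exists>k. runs f (pr m x) (Suc k)"
  shows "runs (CMu f) x n"
  unfolding runs_def
proof
  fix K
  have "reach (pr (push f (push (pr 11 (pr f (pr m x))) K)) (pr m x)) (pr K n)" if "m \<le> n" for m
    using that
  \<comment> \<open>Downward induction from n: a search that has got as far as
    \<open>m \<le> n\<close> ends with n.\<close>
  proof (induction rule: inc_induct)
    case base
    have "reach (pr (push (pr 11 (pr f (pr n x))) K) 0) (pr K n)"
      by (intro reach_push) (simp add: act_def reach_refl)
    then show ?case using assms(1) reach_trans unfolding runs_def by blast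
  next
    case (step m)
    obtain k where k: "runs f (pr m x) (Suc k)" using assms(2) step by blast
    have "reach (pr (push (pr 11 (pr f (pr m x))) K) (Suc k)) (pr K n)"
      using step.IH by (intro reach_push) (simp add: act_def)
    then show ?case using k reach_trans unfolding runs_def by blast
  qed
  from this[of 0] show "reach (pr (push (CMu f) K) x) (pr K n)"
    unfolding CMu_def by (intro reach_push) (simp add: act_def)
qed

definition enc :: "nat list \<Rightarrow> nat" where "enc xs = foldr pr xs 0"

lemma enc_Cons [simp]: "enc (x # xs) = pr x (enc xs)"
  by (simp add: enc_def)

fun comp_proj :: "nat \<Rightarrow> nat" where
  "comp_proj 0 = CFst"
| "comp_proj (Suc i) = CComp (comp_proj i) CSnd"

text \<open>\<open>Oracle\<close> becomes \<open>CZero\<close> because only the constant zero oracle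
  is simulated. Argument lists are nested pairs ending in 0, so \<open>Succ\<close> has to read off
  a first component.\<close>

primrec compile :: "prog \<Rightarrow> nat" where
  "compile Zero = CZero"
| "compile Succ = CComp CSucc CFst"
| "compile (Proj i) = comp_proj i"
| "compile Oracle = CZero"
| "compile (Comp p qs) = CComp (compile p) (foldr CPair (map compile qs) CZero)"
| "compile (PrimRec p q) = CRec (compile p) (compile q)"
| "compile (Mu p) = CMu (compile p)"

lemma runs_proj: "i < length xs \<Longrightarrow> runs (comp_proj i) (enc xs) (xs ! i)"
proof (induction i arbitrary: xs)
  case 0
  then show ?case using runs_Fst[of "enc xs"] by (cases xs) auto
next
  case (Suc i)
  then obtain x ys where xs: "xs = x # ys" by (cases xs) auto
  then show ?case
    using Suc runs_Snd[of "enc xs"] by (auto intro!: runs_Comp)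
qed

lemma runs_foldr_Pair:
  "list_all2 (\<lambda>q y. runs (compile q) x y) qs ys \<Longrightarrow> runs (foldr CPair (map compile qs) CZero) x (enc ys)"
  by (induction rule: list_all2_induct) (auto intro!: runs_Pair simp: enc_def runs_Zero)

lemma runs_compile: "computes (\<lambda>_. 0) p xs y \<Longrightarrow> runs (compile p) (enc xs) y"
proof (induction rule: computes.induct)
  case (computes_Succ x)
  then show ?case using runs_Fst[of "enc [x]"] by (auto intro: runs_Comp runs_Succ)
next
  case (computes_Comp xs qs ys p z)
  have "list_all2 (\<lambda>q y. runs (compile q) (enc xs) y) qs ys"
    using computes_Comp(1) by (rule list_all2_mono) simp
  then show ?case using computes_Comp by (auto intro: runs_Comp runs_foldr_Pair)
next
  case (computes_PrimRec_Suc p q n xs y z)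
  then show ?case by (auto intro: runs_Rec_Suc)
next
  case (computes_Mu p n xs)
  then show ?case by (simp del: enc_Cons add: enc_Cons) (rule runs_Mu; auto)
qed (auto simp: runs_Zero runs_proj runs_Rec_0)

text \<open>
  The argument \<open>t\<close> packs an input of the machine \<open>e\<close> and a number of steps.  If the machine has not
  halted by then, the output \<open>0\<close> is returned, which codes the empty interval.
\<close>

definition uenum :: "nat \<Rightarrow> nat \<Rightarrow> nat" where
  "uenum e t = (let s = (mstep ^^ p2 t) (pr (push e 0) (pr (p1 t) 0)) in
     if p1 s = 0 then p2 s else 0)"

lemma mstep_funpow_halt: "(mstep ^^ n) (pr 0 v) = pr 0 v"
  by (induction n) auto

text \<open>Packing a time bound into t makes \<open>uenum\<close> total; the value
  \<open>g n\<close> appears at a t that grants the machine enough steps on input n.\<close>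

theorem uenum_enumerates:
  assumes "computable_seq g"
  obtains e where "\<And>t. uenum e t \<in> insert 0 (range g)" "\<And>n. \<exists>t. uenum e t = g n"
proof -
  obtain p where p: "\<And>n. computes (\<lambda>_. 0) p [n] (g n)"
    using assms unfolding computable_seq_def by blast
  have "runs (compile p) (pr n 0) (g n)" for n
    using runs_compile[OF p[of n]] by (simp add: enc_def)
  then have "\<exists>m. (mstep ^^ m) (pr (push (compile p) 0) (pr n 0)) = pr 0 (g n)" for n
    unfolding runs_def reach_def by blast
  then obtain h where h: "\<And>n. (mstep ^^ h n) (pr (push (compile p) 0) (pr n 0)) = pr 0 (g n)"
    by metis
  have "\<exists>t. uenum (compile p) t = g n" for n
    by (rule exI[of _ "pr n (h n)"]) (simp add: uenum_def h)
  moreover have "uenum (compile p) t \<in> insert 0 (range g)" for t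
  proof -
    define n m where "n = p1 t" and "m = p2 t"
    let ?s = "(mstep ^^ m) (pr (push (compile p) 0) (pr n 0))"
    have "p2 ?s = g n" if "p1 ?s = 0"
    proof -
      have "?s = pr 0 (p2 ?s)" using that by (metis pr_p1_p2)
      \<comment> \<open>Running m and then \<open>h n\<close> steps equals running
        \<open>h n\<close> and then m steps. The first order preserves the halted output, the second
        yields \<open>g n\<close>.\<close>
      then have "(mstep ^^ h n) ?s = pr 0 (p2 ?s)" by (metis mstep_funpow_halt)
      moreover have "(mstep ^^ h n) ?s = pr 0 (g n)"
        by (metis h mstep_funpow_halt add.commute comp_apply funpow_add)
      ultimately show ?thesis by (metis p2_pr)
    qed
    then show ?thesis by (auto simp: uenum_def Let_def n_def m_def)
  qed
  ultimately show ?thesis using that by blast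
qed

lemma cmp_push [cmp_intros]: "cmp f \<Longrightarrow> cmp g \<Longrightarrow> cmp (\<lambda>x. push (f x) (g x))"
  unfolding push_def by (intro cmp_intros)

lemma cmp_act [cmp_intros]:
  "cmp t \<Longrightarrow> cmp a \<Longrightarrow> cmp K \<Longrightarrow> cmp v \<Longrightarrow> cmp (\<lambda>x. act (t x) (a x) (K x) (v x))"
  unfolding act_def by (intro cmp_intros)

lemma cmp_mstep [cmp_intros]: "cmp f \<Longrightarrow> cmp (\<lambda>x. mstep (f x))"
  unfolding mstep_def by (intro cmp_intros)

lemma cmp_uenum [cmp_intros]: "cmp e \<Longrightarrow> cmp t \<Longrightarrow> cmp (\<lambda>x. uenum (e x) (t x))"
  unfolding uenum_def Let_def by (intro cmp_intros)

section \<open>The construction\<close>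

definition absn :: "nat \<Rightarrow> nat" where
  "absn a = (if even a then a div 2 else Suc (a div 2))"

text \<open>Odd numbers code the negative integers, so a quotient has negative sign when the
  parities differ. With numerator 0 this is a negative zero, which \<open>code_less\<close> has to
  exclude.\<close>

definition neg :: "nat \<Rightarrow> bool" where
  "neg u \<longleftrightarrow> even (p1 u) \<noteq> even (p2 u)"

lemma int_decode_eq_absn: "int_decode a = (if even a then 1 else - 1) * int (absn a)"
  by (simp add: int_decode_def sum_decode_def absn_def)

lemma rational_code_eq:
  "rational_code u = (if neg u then - 1 else 1) * (real (absn (p1 u)) / real (absn (p2 u)))"
  unfolding rational_code_def nat_to_rat_surj_def neg_def p1_def p2_def
  by (cases "prod_decode u") (simp add: Fract_of_int_quotient of_rat_divide of_rat_minus int_decode_eq_absn)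

text \<open>Cross-multiplied comparison with \<open>k / n\<close>. A zero denominator codes 0,
  because HOL sets division by zero to 0; a truly negative rational lies below every
  \<open>k / n\<close>.\<close>

definition code_less :: "nat \<Rightarrow> nat \<Rightarrow> nat \<Rightarrow> bool" where
  "code_less u k n \<longleftrightarrow>
     (if absn (p2 u) = 0 then 0 < k
      else absn (p1 u) * n < k * absn (p2 u) \<or> (neg u \<and> absn (p1 u) \<noteq> 0))"

definition code_greater :: "nat \<Rightarrow> nat \<Rightarrow> nat \<Rightarrow> bool" where
  "code_greater u k n \<longleftrightarrow>
     absn (p2 u) \<noteq> 0 \<and> \<not> neg u \<and> k * absn (p2 u) < absn (p1 u) * n"

lemma divide_less_divide_nat_iff:
  "0 < b \<Longrightarrow> 0 < d \<Longrightarrow> real a / real b < real c / real d \<longleftrightarrow> a * d < c * b"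
  by (simp add: field_simps flip: of_nat_mult)

lemma code_less_iff: "0 < n \<Longrightarrow> code_less u k n \<longleftrightarrow> rational_code u < real k / real n"
proof -
  assume n: "0 < n"
  have "- (real a / real b) < real k / real n \<longleftrightarrow> a * n < k * b \<or> a \<noteq> 0" if "0 < b" for a b
  proof (cases "a = 0")
    case False
    then have "- (real a / real b) < 0" using that by simp
    also have "0 \<le> real k / real n" by simp
    finally show ?thesis using False by simp
  qed (use n that in \<open>simp add: zero_less_divide_iff\<close>)
  then show ?thesis
    using n by (auto simp: code_less_def rational_code_eq divide_less_divide_nat_iff zero_less_divide_iff)
qed

lemma code_greater_iff: "0 < n \<Longrightarrow> code_greater u k n \<longleftrightarrow> real k / real n < rational_code u"
proof -
  assume n: "0 < n"
  have "\<not> real k / real n < - (real a / real b)" for a b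
  proof -
    have "- (real a / real b) \<le> 0" "0 \<le> real k / real n" by simp_all
    then show ?thesis by linarith
  qed
  then show ?thesis
    using n by (cases "absn (p2 u) = 0")
      (auto simp: code_greater_def rational_code_eq divide_less_divide_nat_iff not_less)
qed

text \<open>
  Stage \<open>s\<close> divides the unit interval into \<open>cells s\<close> equal cells; the \<open>k\<close>-th of them carries
  the mass \<open>weight s k / total s\<close>.
\<close>

definition cells :: "nat \<Rightarrow> nat" where "cells s = 2 ^ triangle s"

text \<open>The exponent is the sum of \<open>2 * r + 1\<close> over r < s, because the factors of
  stage r add up to \<open>2 * 4 ^ r\<close> in each cell. Likewise \<open>triangle s\<close> in
  \<open>cells\<close> sums the exponents \<open>r + 1\<close> of the subdivisions.\<close>

definition total :: "nat \<Rightarrow> nat" where "total s = 2 ^ (s * s)"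

text \<open>Containment of the closed cell in a single interval is decidable. Shrinking cells around
  a point of an enumerated interval eventually fit into it, so the test still exhausts the
  complement.\<close>

definition removed :: "nat \<Rightarrow> nat \<Rightarrow> nat \<Rightarrow> bool" where
  "removed e s k \<longleftrightarrow> (\<exists>t<s. code_less (p1 (uenum e t)) k (cells s) \<and>
     code_greater (p2 (uenum e t)) (Suc k) (cells s))"

text \<open>
  The \<open>i\<close>-th requirement concerns the effectively closed set with index \<open>p1 i\<close>, so that every set is
  treated by infinitely many requirements.  It works on one cell of stage \<open>i + 2\<close> at a time, and is
  finished with the cell \<open>m\<close> once the part of \<open>m\<close> not yet removed has relative mass at most \<open>1 / 2 ^ i\<close>.
\<close>

definition finished :: "nat \<Rightarrow> nat \<Rightarrow> nat \<Rightarrow> nat \<Rightarrow> bool" where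
  "finished c i s m \<longleftrightarrow>
     (let d = cells s div cells (i + 2) in
       (\<Sum>j<d. if removed (p1 i) s (m * d + j) then 0 else look (cells s) c (m * d + j)) * 2 ^ i
         \<le> (\<Sum>j<d. look (cells s) c (m * d + j)))"

definition locks :: "nat \<Rightarrow> nat \<Rightarrow> nat \<Rightarrow> nat \<Rightarrow> bool" where
  "locks c i s k \<longleftrightarrow>
     (let m = k div (cells s div cells (i + 2)) in \<not> finished c i s m \<and> (\<forall>l<m. finished c i s l))"

text \<open>The bound \<open>i < s - 1\<close> amounts to \<open>i + 2 \<le> s\<close>: requirement
  i starts once the grid refines its cells of stage \<open>i + 2\<close>.\<close>

definition locked :: "nat \<Rightarrow> nat \<Rightarrow> nat \<Rightarrow> bool" where
  "locked c s k \<longleftrightarrow> (\<exists>i<s - 1. locks c i s k)"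

text \<open>
  Every cell is cut into two halves, and each half into \<open>2 ^ s\<close> pieces.  In a locked cell the mass is
  spread evenly; otherwise almost all of it goes to the first piece of each half.  The factors
  add up to \<open>2 * 4 ^ s\<close> in both cases.  The halving keeps atoms from arising.
\<close>

definition factor :: "nat \<Rightarrow> nat \<Rightarrow> nat \<Rightarrow> nat" where
  "factor c s k = (if locked c s (k div 2 ^ Suc s) then 2 ^ s
     else if k mod 2 ^ s = 0 then 4 ^ s - 2 ^ s + 1 else 1)"

text \<open>Testing \<open>finished\<close> takes sums over whole blocks, so the recursion carries
  the complete table of a stage, coded as one number. Integer weights keep these tests
  exact.\<close>

definition state :: "nat \<Rightarrow> nat" where
  "state = rec_nat (tab 1 (\<lambda>_. 1))
     (\<lambda>s c. tab (cells (Suc s)) (\<lambda>k. look (cells s) c (k div 2 ^ Suc s) * factor c s k))"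

definition weight :: "nat \<Rightarrow> nat \<Rightarrow> nat" where
  "weight s k = look (cells s) (state s) k"

definition cum :: "nat \<Rightarrow> nat \<Rightarrow> nat" where
  "cum s k = (\<Sum>j<k. weight s j)"

text \<open>A name of a point of the unit interval may use rationals outside of it, whence the
  clipping at both ends. A zero denominator gives 0, in agreement with
  \<open>rational_code\<close>.\<close>

definition approx_cell :: "nat \<Rightarrow> nat \<Rightarrow> nat" where
  "approx_cell s q = (if neg q then 0
     else let k = absn (p1 q) * cells s div absn (p2 q) in if k \<le> cells s then k else cells s)"

text \<open>
  Codes a rational within \<open>1 / 2 ^ n\<close> of the value at every point whose distance from
  \<open>rational_code q\<close> is at most \<open>1 / cells (Suc n)\<close>.
\<close>

definition approx_value :: "nat \<Rightarrow> nat \<Rightarrow> nat" where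
  "approx_value n q = pr (2 * cum (Suc n) (approx_cell (Suc n) q)) (2 * total (Suc n))"

subsection \<open>Computability of the construction\<close>

lemma cmp_absn [cmp_intros]: "cmp f \<Longrightarrow> cmp (\<lambda>x. absn (f x))"
  unfolding absn_def by (intro cmp_intros)

lemma cmpP_neg [cmp_intros]: "cmp f \<Longrightarrow> cmpP (\<lambda>x. neg (f x))"
  unfolding neg_def by (intro cmp_intros)

lemma cmpP_if: "cmpP P \<Longrightarrow> cmpP Q \<Longrightarrow> cmpP R \<Longrightarrow> cmpP (\<lambda>x. if P x then Q x else R x)"
  by (rule cmpP_cong[where P="\<lambda>x. P x \<and> Q x \<or> \<not> P x \<and> R x"], intro cmp_intros) auto

lemma cmpP_code_less [cmp_intros]:
  "cmp u \<Longrightarrow> cmp k \<Longrightarrow> cmp n \<Longrightarrow> cmpP (\<lambda>x. code_less (u x) (k x) (n x))"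
  unfolding code_less_def by (intro cmpP_if cmp_intros)

lemma cmpP_code_greater [cmp_intros]:
  "cmp u \<Longrightarrow> cmp k \<Longrightarrow> cmp n \<Longrightarrow> cmpP (\<lambda>x. code_greater (u x) (k x) (n x))"
  unfolding code_greater_def by (intro cmp_intros)

lemma cmp_cells [cmp_intros]: "cmp f \<Longrightarrow> cmp (\<lambda>x. cells (f x))"
  unfolding cells_def by (intro cmp_intros)

lemma cmp_total [cmp_intros]: "cmp f \<Longrightarrow> cmp (\<lambda>x. total (f x))"
  unfolding total_def by (intro cmp_intros)

text \<open>
  In the body of a bounded operator the parameters become functions of the first component of a pair.
\<close>

lemma cmp_comp_p1 [cmp_intros]: "cmp f \<Longrightarrow> cmp (\<lambda>z. f (p1 z))"
  by (rule cmp_comp[of f]) (assumption, intro cmp_intros)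

lemma cmpP_removed [cmp_intros]:
  "cmp e \<Longrightarrow> cmp s \<Longrightarrow> cmp k \<Longrightarrow> cmpP (\<lambda>x. removed (e x) (s x) (k x))"
  unfolding removed_def by (intro cmp_intros)

lemma cmpP_finished [cmp_intros]:
  "cmp c \<Longrightarrow> cmp i \<Longrightarrow> cmp s \<Longrightarrow> cmp m \<Longrightarrow> cmpP (\<lambda>x. finished (c x) (i x) (s x) (m x))"
  unfolding finished_def Let_def by (intro cmp_intros)

lemma cmpP_locks [cmp_intros]:
  "cmp c \<Longrightarrow> cmp i \<Longrightarrow> cmp s \<Longrightarrow> cmp k \<Longrightarrow> cmpP (\<lambda>x. locks (c x) (i x) (s x) (k x))"
  unfolding locks_def Let_def by (intro cmp_intros)

lemma cmpP_locked [cmp_intros]: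
  "cmp c \<Longrightarrow> cmp s \<Longrightarrow> cmp k \<Longrightarrow> cmpP (\<lambda>x. locked (c x) (s x) (k x))"
  unfolding locked_def by (intro cmp_intros)

lemma cmp_factor [cmp_intros]:
  "cmp c \<Longrightarrow> cmp s \<Longrightarrow> cmp k \<Longrightarrow> cmp (\<lambda>x. factor (c x) (s x) (k x))"
  unfolding factor_def by (intro cmp_intros)

lemma cmp_state [cmp_intros]: "cmp f \<Longrightarrow> cmp (\<lambda>x. state (f x))"
  unfolding state_def by (intro cmp_intros)

lemma cmp_cum [cmp_intros]: "cmp s \<Longrightarrow> cmp k \<Longrightarrow> cmp (\<lambda>x. cum (s x) (k x))"
  unfolding cum_def weight_def by (intro cmp_intros)

lemma cmp_approx_value: "cmp (\<lambda>z. approx_value (p1 z) (p2 z))"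
  unfolding approx_value_def approx_cell_def Let_def by (intro cmp_intros)

text \<open>The only query to the oracle asks for the approximation of the argument up to \<open>1 / cells (Suc n)\<close>.\<close>

lemma approx_value_program:
  obtains p where "\<And>\<phi> n. computes \<phi> p [n] (approx_value n (\<phi> (triangle (Suc n))))"
proof -
  have "recf 2 (\<lambda>ys. (\<lambda>z. approx_value (p1 z) (p2 z)) (pr (ys ! 0) (ys ! 1)))"
    by (rule recf_comp1) (use cmp_approx_value in \<open>auto simp: cmp_def intro!: recf_pr recf_nth\<close>)
  then obtain p where p: "\<And>\<phi> xs. length xs = 2 \<Longrightarrow> computes \<phi> p xs (approx_value (xs ! 0) (xs ! 1))"
    unfolding recf_def by auto
  have "recf 1 (\<lambda>xs. triangle (Suc (xs ! 0)))"
    by (intro recf_triangle recf_Suc recf_nth) simp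
  then obtain q where q: "\<And>\<phi> xs. length xs = 1 \<Longrightarrow> computes \<phi> q xs (triangle (Suc (xs ! 0)))"
    unfolding recf_def by auto
  have "computes \<phi> (Comp p [Proj 0, Comp Oracle [q]]) [n] (approx_value n (\<phi> (triangle (Suc n))))"
    for \<phi> n
  proof (rule computes_Comp[where ys="[n, \<phi> (triangle (Suc n))]"])
    have "computes \<phi> (Comp Oracle [q]) [n] (\<phi> (triangle (Suc n)))"
      using q[of "[n]" \<phi>] by (intro computes_Comp[where ys="[triangle (Suc n)]"] computes_Oracle) auto
    then show "list_all2 (\<lambda>q y. computes \<phi> q [n] y) [Proj 0, Comp Oracle [q]]
        [n, \<phi> (triangle (Suc n))]"
      using computes_Proj[of 0 "[n]" \<phi>] by simp
    show "computes \<phi> p [n, \<phi> (triangle (Suc n))] (approx_value n (\<phi> (triangle (Suc n))))"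
      using p[of "[n, \<phi> (triangle (Suc n))]" \<phi>] by simp
  qed
  then show ?thesis by (rule that)
qed

section \<open>The masses of the cells\<close>

lemma cells_pos [simp]: "0 < cells s"
  by (simp add: cells_def)

lemma cells_neq_0 [simp]: "cells s \<noteq> 0"
  by (simp add: cells_def)

lemma total_pos [simp]: "0 < total s"
  by (simp add: total_def)

lemma cells_0 [simp]: "cells 0 = 1"
  by (simp add: cells_def)

lemma cells_Suc: "cells (Suc s) = cells s * 2 ^ Suc s"
  by (simp add: cells_def power_add)

lemma total_Suc: "total (Suc s) = total s * (2 * 4 ^ s)"
proof -
  have "Suc s * Suc s = s * s + Suc (2 * s)" by simp
  then show ?thesis
    by (simp add: total_def power_add power_mult del: mult_Suc mult_Suc_right)
qed

lemma cells_ge: "2 ^ s \<le> cells s"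
proof -
  have "s \<le> triangle s" by (induction s) auto
  then show ?thesis by (simp add: cells_def)
qed

section \<open>Nested grids and conservation of mass\<close>

definition ratio :: "nat \<Rightarrow> nat \<Rightarrow> nat" where
  "ratio s t = cells t div cells s"

lemma cells_ratio: "s \<le> t \<Longrightarrow> cells t = cells s * ratio s t"
  unfolding ratio_def cells_def
  by (metis dvd_mult_div_cancel le_imp_power_dvd triangle_mono)

lemma ratio_pos: "s \<le> t \<Longrightarrow> 0 < ratio s t"
  using cells_ratio[of s t] cells_pos[of t] by (metis gr0I mult_0_right less_irrefl)

lemma ratio_self [simp]: "ratio s s = 1"
  by (simp add: ratio_def)

lemma ratio_Suc: "s \<le> t \<Longrightarrow> ratio s (Suc t) = ratio s t * 2 ^ Suc t"
  unfolding ratio_def cells_Suc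
  by (rule dvd_div_mult[symmetric]) (simp add: cells_def le_imp_power_dvd triangle_mono)

lemma ratio_cell_less: "s \<le> t \<Longrightarrow> m < cells s \<Longrightarrow> j < ratio s t \<Longrightarrow> m * ratio s t + j < cells t"
proof -
  assume *: "s \<le> t" "m < cells s" "j < ratio s t"
  have "m * ratio s t + j < Suc m * ratio s t" using * by simp
  also have "\<dots> \<le> cells s * ratio s t" using * by (intro mult_le_mono1) simp
  finally show ?thesis using * by (simp add: cells_ratio)
qed

lemma sum_lessThan_mult:
  fixes h :: "nat \<Rightarrow> 'a::comm_monoid_add"
  shows "(\<Sum>j<a * b. h j) = (\<Sum>l<a. \<Sum>i<b. h (l * b + i))"
proof -
  have shift: "sum h {l * b..<l * b + b} = (\<Sum>i<b. h (l * b + i))" for l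
    using sum.shift_bounds_nat_ivl[of h 0 "l * b" b] by (simp add: lessThan_atLeast0 add.commute)
  have "(\<Sum>j<a * b. h j) = (\<Sum>l<a. sum h {l * b..<l * b + b})"
    by (rule sum.nat_group[symmetric])
  also have "\<dots> = (\<Sum>l<a. \<Sum>i<b. h (l * b + i))"
    by (simp only: shift)
  finally show ?thesis .
qed

lemma state_0: "state 0 = tab 1 (\<lambda>_. 1)"
  and state_Suc: "state (Suc s) = tab (cells (Suc s)) (\<lambda>k. weight s (k div 2 ^ Suc s) * factor (state s) s k)"
  by (simp_all add: state_def weight_def)

lemma weight_0: "weight 0 0 = 1"
  unfolding weight_def state_0 cells_0 by (simp add: look_tab)

lemma weight_Suc:
  "k < cells (Suc s) \<Longrightarrow> weight (Suc s) k = weight s (k div 2 ^ Suc s) * factor (state s) s k"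
  unfolding weight_def[of "Suc s"] state_Suc by (rule look_tab)

text \<open>In an unlocked cell each half receives one large factor and \<open>2 ^ s - 1\<close>
  ones, together \<open>4 ^ s\<close>; in a locked cell \<open>2 ^ Suc s\<close> factors
  \<open>2 ^ s\<close> give the same total.\<close>

lemma sum_factor: "(\<Sum>j<2 ^ Suc s. factor c s (k * 2 ^ Suc s + j)) = 2 * 4 ^ s"
proof (cases "locked c s k")
  case True
  then have "(\<Sum>j<2 ^ Suc s. factor c s (k * 2 ^ Suc s + j)) = (\<Sum>j<(2::nat) ^ Suc s. 2 ^ s)"
    by (intro sum.cong) (auto simp: factor_def)
  then show ?thesis by (simp flip: power_mult_distrib)
next
  case False
  have "factor c s (k * 2 ^ Suc s + (l * 2 ^ s + i)) = (if i = 0 then 4 ^ s - 2 ^ s + 1 else 1)"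
    if "l < 2" "i < 2 ^ s" for l i
  proof -
    have "l * 2 ^ s + i < 2 ^ Suc s" using that by (cases l) auto
    then have "(k * 2 ^ Suc s + (l * 2 ^ s + i)) div 2 ^ Suc s = k" by simp
    moreover have "(k * 2 ^ Suc s + (l * 2 ^ s + i)) mod 2 ^ s = i"
    proof -
      have eq: "k * 2 ^ Suc s + (l * 2 ^ s + i) = i + (2 * k + l) * 2 ^ s" by (simp add: algebra_simps)
      show ?thesis unfolding eq using that by simp
    qed
    ultimately show ?thesis using False by (simp add: factor_def)
  qed
  then have "(\<Sum>j<2 * 2 ^ s. factor c s (k * 2 ^ Suc s + j))
      = (\<Sum>l<2::nat. \<Sum>i<(2::nat) ^ s. if i = 0 then 4 ^ s - 2 ^ s + 1 else 1)"
    unfolding sum_lessThan_mult by (intro sum.cong) auto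
  also have "\<dots> = 2 * (\<Sum>i<(2::nat) ^ s. (if i = 0 then 4 ^ s - 2 ^ s else 0) + 1)"
    by (auto intro!: sum.cong)
  also have "\<dots> = 2 * (4 ^ s - 2 ^ s + 2 ^ s)"
    by (subst sum.distrib) (simp add: sum.delta')
  also have "\<dots> = 2 * 4 ^ s" by (simp add: power_mono)
  finally show ?thesis by simp
qed

definition mass :: "nat \<Rightarrow> nat \<Rightarrow> real" where
  "mass s k = real (weight s k) / real (total s)"

lemma mass_Suc:
  assumes "k < cells s" "j < 2 ^ Suc s"
  shows "mass (Suc s) (k * 2 ^ Suc s + j)
    = mass s k * (real (factor (state s) s (k * 2 ^ Suc s + j)) / (2 * 4 ^ s))"
proof -
  have "k * 2 ^ Suc s + j < cells (Suc s)"
    using ratio_cell_less[of s "Suc s" k j] assms by (simp add: ratio_Suc)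
  moreover have "(k * 2 ^ Suc s + j) div 2 ^ Suc s = k" using assms by simp
  ultimately show ?thesis
    by (simp only: mass_def weight_Suc total_Suc) simp
qed

lemma mass_block:
  assumes "k < cells s"
  shows "(\<Sum>j<2 ^ Suc s. mass (Suc s) (k * 2 ^ Suc s + j)) = mass s k"
proof -
  have "(\<Sum>j<2 ^ Suc s. mass (Suc s) (k * 2 ^ Suc s + j))
      = (\<Sum>j<2 ^ Suc s. mass s k * (real (factor (state s) s (k * 2 ^ Suc s + j)) / (2 * 4 ^ s)))"
    by (intro sum.cong refl mass_Suc assms) auto
  also have "\<dots> = mass s k * (real (\<Sum>j<2 ^ Suc s. factor (state s) s (k * 2 ^ Suc s + j)) / (2 * 4 ^ s))"
    by (simp only: sum_distrib_left sum_divide_distrib of_nat_sum)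
  also have "\<dots> = mass s k" unfolding sum_factor by simp
  finally show ?thesis .
qed

lemma mass_desc:
  assumes "s \<le> t" "k < cells s"
  shows "(\<Sum>j<ratio s t. mass t (k * ratio s t + j)) = mass s k"
  using assms(1)
proof (induction rule: dec_induct)
  case (step t)
  let ?r = "ratio s t"
  have "(\<Sum>j<ratio s (Suc t). mass (Suc t) (k * ratio s (Suc t) + j))
      = (\<Sum>l<?r. \<Sum>i<2 ^ Suc t. mass (Suc t) ((k * ?r + l) * 2 ^ Suc t + i))"
    unfolding ratio_Suc[OF step.hyps(1)] sum_lessThan_mult by (simp add: algebra_simps)
  also have "\<dots> = (\<Sum>l<?r. mass t (k * ?r + l))"
    using step assms by (intro sum.cong refl mass_block ratio_cell_less) auto
  finally show ?case using step.IH by simp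
qed simp

lemma factor_le: "factor c s k \<le> 4 ^ s"
proof -
  have "(2::nat) ^ s \<le> 4 ^ s" "(1::nat) \<le> 2 ^ s" by (simp_all add: power_mono)
  then have "4 ^ s - 2 ^ s + 1 \<le> (4::nat) ^ s" "(1::nat) \<le> 4 ^ s" by linarith+
  then show ?thesis using \<open>2 ^ s \<le> 4 ^ s\<close> unfolding factor_def by presburger
qed

lemma factor_pos: "0 < factor c s k"
  by (simp add: factor_def)

lemma cell_split:
  assumes "k < cells (Suc s)"
  obtains l j where "k = l * 2 ^ Suc s + j" "l < cells s" "j < 2 ^ Suc s"
proof (rule that[of "k div 2 ^ Suc s" "k mod 2 ^ Suc s"])
  show "k div 2 ^ Suc s < cells s"
    using assms by (simp add: cells_Suc less_mult_imp_div_less)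
  show "k = k div 2 ^ Suc s * 2 ^ Suc s + k mod 2 ^ Suc s"
    by (rule div_mult_mod_eq[symmetric])
qed simp

text \<open>The small pieces keep factor 1 instead of 0, so no cell ever becomes empty; strict
  monotonicity of \<open>fn\<close> rests on this.\<close>

lemma mass_pos: "k < cells s \<Longrightarrow> 0 < mass s k"
proof (induction s arbitrary: k)
  case 0
  then show ?case by (simp add: mass_def weight_0)
next
  case (Suc s)
  from Suc.prems obtain l j where "k = l * 2 ^ Suc s + j" "l < cells s" "j < 2 ^ Suc s"
    by (rule cell_split)
  then show ?case using Suc.IH[of l] factor_pos by (simp only: mass_Suc) simp
qed

text \<open>A factor is at most \<open>4 ^ s\<close> out of \<open>2 * 4 ^ s\<close>, so no piece
  inherits more than half of its cell. This rate drives both the continuity of \<open>fn\<close> and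
  the error bound of its computation.\<close>

lemma mass_le: "k < cells s \<Longrightarrow> mass s k \<le> 1 / 2 ^ s"
proof (induction s arbitrary: k)
  case 0
  then show ?case by (simp add: mass_def weight_0 total_def)
next
  case (Suc s)
  from Suc.prems obtain l j where k: "k = l * 2 ^ Suc s + j" "l < cells s" "j < 2 ^ Suc s"
    by (rule cell_split)
  have "real (factor (state s) s k) \<le> 4 ^ s"
    using factor_le[of "state s" s k] by (metis of_nat_le_iff of_nat_numeral of_nat_power)
  then have "mass s l * (real (factor (state s) s k) / (2 * 4 ^ s)) \<le> 1 / 2 ^ s * (1 / 2)"
    by (intro mult_mono Suc.IH k) (auto simp: field_simps)
  then show ?case using k by (simp only: mass_Suc) simp
qed

section \<open>The function\<close>

definition gr :: "nat \<Rightarrow> nat \<Rightarrow> real" where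
  "gr s k = (\<Sum>j<k. mass s j)"

lemma gr_0 [simp]: "gr s 0 = 0"
  by (simp add: gr_def)

lemma gr_eq_cum: "gr s k = real (cum s k) / real (total s)"
  by (simp add: gr_def cum_def mass_def sum_divide_distrib)

text \<open>Grid values are final, because later stages move mass only inside the cells of stage
  s.\<close>

lemma gr_refine:
  assumes "s \<le> t" "k \<le> cells s"
  shows "gr t (k * ratio s t) = gr s k"
  unfolding gr_def sum_lessThan_mult using assms by (intro sum.cong refl mass_desc) auto

lemma gr_cells [simp]: "gr s (cells s) = 1"
  using gr_refine[of 0 s 1] by (simp add: cells_ratio[of 0 s] gr_def mass_def weight_0 total_def)

lemma gr_diff: "k \<le> l \<Longrightarrow> gr s l - gr s k = (\<Sum>j\<in>{k..<l}. mass s j)"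
  unfolding gr_def lessThan_atLeast0 by (rule sum_diff_nat_ivl) auto

lemma gr_mono: "k \<le> l \<Longrightarrow> l \<le> cells s \<Longrightarrow> gr s k \<le> gr s l"
  using gr_diff[of k l s] sum_nonneg[of "{k..<l}" "mass s"] mass_pos[of _ s] by (force simp: less_imp_le)

lemma gr_Suc: "gr s (Suc k) = gr s k + mass s k"
  by (simp add: gr_def)

lemma gr_diff_le: "k \<le> l \<Longrightarrow> l \<le> cells s \<Longrightarrow> gr s l - gr s k \<le> real (l - k) / 2 ^ s"
  using gr_diff[of k l s] sum_bounded_above[of "{k..<l}" "mass s" "1 / 2 ^ s"] mass_le[of _ s]
  by force

lemma gr_le_gr:
  assumes "k \<le> cells s" "l \<le> cells t" "real k / cells s \<le> real l / cells t"
  shows "gr s k \<le> gr t l"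
proof -
  define u where "u = max s t"
  have u: "s \<le> u" "t \<le> u" by (auto simp: u_def)
  have pos: "0 < real (ratio s u)" "0 < real (ratio t u)" using u ratio_pos by auto
  have "real k * real (ratio s u) = real k / cells s * cells u"
    using cells_ratio[OF u(1)] by simp
  also have "\<dots> \<le> real l / cells t * cells u"
    using assms(3) by (intro mult_right_mono) auto
  also have "\<dots> = real l * real (ratio t u)"
    using cells_ratio[OF u(2)] by simp
  finally have "k * ratio s u \<le> l * ratio t u"
    by (metis of_nat_le_iff of_nat_mult)
  moreover have "l * ratio t u \<le> cells u"
    using assms(2) cells_ratio[OF u(2)] by (metis mult_le_mono1)
  ultimately have "gr u (k * ratio s u) \<le> gr u (l * ratio t u)" by (rule gr_mono)
  then show ?thesis using gr_refine u assms by simp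
qed

text \<open>A supremum over all stages spares a convergence argument; \<open>fn_lower\<close> and
  \<open>fn_upper\<close> bracket it between grid values.\<close>

definition fn :: "real \<Rightarrow> real" where
  "fn x = Sup {gr s k | s k. k \<le> cells s \<and> real k / cells s \<le> x}"

lemma fn_lower: "k \<le> cells s \<Longrightarrow> real k / cells s \<le> x \<Longrightarrow> gr s k \<le> fn x"
  unfolding fn_def
proof (rule cSup_upper)
  have "gr t l \<le> 1" if "l \<le> cells t" for t l
    using gr_mono[OF that order_refl] by simp
  then show "bdd_above {gr s k | s k. k \<le> cells s \<and> real k / cells s \<le> x}"
    by (intro bdd_aboveI[of _ 1]) auto
qed auto

lemma fn_upper:
  assumes "0 \<le> x" "k \<le> cells s" "x \<le> real k / cells s"
  shows "fn x \<le> gr s k"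
  unfolding fn_def
proof (rule cSup_least)
  have "gr 0 0 \<in> {gr s k | s k. k \<le> cells s \<and> real k / cells s \<le> x}" using assms(1) by force
  then show "{gr s k | s k. k \<le> cells s \<and> real k / cells s \<le> x} \<noteq> {}" by blast
next
  fix y assume "y \<in> {gr s k | s k. k \<le> cells s \<and> real k / cells s \<le> x}"
  then obtain t l where "y = gr t l" "l \<le> cells t" "real l / cells t \<le> x" by blast
  then show "y \<le> gr s k" using assms by (auto intro!: gr_le_gr)
qed

lemma fn_grid: "k \<le> cells s \<Longrightarrow> fn (real k / cells s) = gr s k"
  by (intro antisym fn_lower fn_upper) auto

lemma fn_0: "fn 0 = 0" and fn_1: "fn 1 = 1"
  using fn_grid[of 0 0] fn_grid[of 1 0] gr_cells[of 0] by auto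

lemma cells_large: "0 < e \<Longrightarrow> \<exists>s\<ge>n. 1 / real (cells s) < e"
proof -
  assume "0 < e"
  then obtain m where m: "1 / 2 ^ m < e"
    using one_less_inverse_iff real_arch_pow_inv[of e "1/2"] by (auto simp: power_one_over)
  have "1 / real (cells (max n m)) \<le> 1 / 2 ^ m"
  proof (rule divide_left_mono)
    have "(2::nat) ^ m \<le> 2 ^ max n m" by (intro power_increasing) auto
    then have "2 ^ m \<le> cells (max n m)" using cells_ge le_trans by blast
    then show "2 ^ m \<le> real (cells (max n m))" by (metis of_nat_le_iff of_nat_numeral of_nat_power)
  qed auto
  then show ?thesis using m by (intro exI[of _ "max n m"]) auto
qed

lemma grid_below:
  assumes "0 \<le> x"
  obtains k where "real k / cells s \<le> x" "x < real (Suc k) / cells s"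
proof
  let ?k = "nat \<lfloor>x * cells s\<rfloor>"
  have "0 \<le> x * cells s" using assms by simp
  then have "real ?k \<le> x * cells s" "x * cells s < real (Suc ?k)" by linarith+
  then show "real ?k / cells s \<le> x" "x < real (Suc ?k) / cells s"
    by (simp_all add: pos_divide_le_eq pos_less_divide_eq)
qed

lemma grid_le_1: "real k / cells s \<le> 1 \<longleftrightarrow> k \<le> cells s"
  by (simp add: pos_divide_le_eq)

text \<open>A fine enough grid has an entire cell between x and y, and every cell has positive
  mass.\<close>

lemma fn_strict_mono: "strict_mono_on {0..1} fn"
proof (rule strict_mono_onI)
  fix x y :: real assume xy: "x \<in> {0..1}" "y \<in> {0..1}" "x < y"
  then obtain s where s: "1 / real (cells s) < (y - x) / 2"
    using cells_large[of "(y - x) / 2" 0] by auto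
  obtain k where k: "real k / cells s \<le> x" "x < real (Suc k) / cells s"
    using grid_below xy by auto
  have "real (Suc (Suc k)) / cells s = real k / cells s + 2 * (1 / cells s)"
    by (simp add: add_divide_distrib)
  also have "\<dots> \<le> x + (y - x)" using s k by (intro add_mono) auto
  finally have le: "real (Suc (Suc k)) / cells s \<le> y" by simp
  then have "real (Suc (Suc k)) / cells s \<le> 1" using xy by (meson atLeastAtMost_iff order_trans)
  then have "Suc (Suc k) \<le> cells s" by (simp only: grid_le_1)
  then have "fn x \<le> gr s (Suc k)"
    using xy k by (intro fn_upper) auto
  also have "\<dots> < gr s (Suc (Suc k))"
    using mass_pos[of "Suc k" s] \<open>Suc (Suc k) \<le> cells s\<close> by (simp add: gr_Suc)
  also have "\<dots> \<le> fn y"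
    using le \<open>Suc (Suc k) \<le> cells s\<close> by (rule fn_lower[rotated])
  finally show "fn x < fn y" .
qed

lemma fn_mono: "0 \<le> x \<Longrightarrow> x \<le> y \<Longrightarrow> y \<le> 1 \<Longrightarrow> fn x \<le> fn y"
  using strict_mono_on_leD[OF fn_strict_mono, of x y] by auto

text \<open>The tolerance is asymmetric: an inexact argument costs up to one cell in either
  direction, and rounding down in \<open>approx_cell\<close> one more on one side. The cases
  \<open>k = 0\<close> and \<open>k = cells s\<close> account for the clipping.\<close>

lemma fn_approx:
  fixes x :: real
  assumes "x \<in> {0..1}" "k \<le> cells s"
    "k = 0 \<or> real k - 1 \<le> x * cells s" "k = cells s \<or> x * cells s \<le> real k + 2"
  shows "\<bar>fn x - gr s k\<bar> \<le> 2 / 2 ^ s"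
proof -
  have "gr s k - 1 / 2 ^ s \<le> fn x"
  proof -
    have "gr s k \<le> gr s (k - 1) + 1 / 2 ^ s"
      using gr_diff_le[of "k - 1" k s] assms(2) by (cases k) auto
    moreover have "gr s (k - 1) \<le> fn x"
      using assms by (intro fn_lower; cases k) (auto simp: pos_divide_le_eq)
    ultimately show ?thesis by simp
  qed
  moreover have "fn x \<le> gr s k + 2 / 2 ^ s"
  proof -
    let ?l = "min (k + 2) (cells s)"
    have "gr s ?l - gr s k \<le> real (?l - k) / 2 ^ s"
      using assms(2) by (intro gr_diff_le) auto
    also have "\<dots> \<le> 2 / 2 ^ s" by (intro divide_right_mono) auto
    finally have "gr s ?l \<le> gr s k + 2 / 2 ^ s" by simp
    moreover have "fn x \<le> gr s ?l"
    proof (rule fn_upper)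
      have "x * cells s \<le> real (cells s)" using assms(1) by (simp add: mult_left_le_one_le)
      then show "x \<le> real ?l / cells s"
        using assms(2,4) by (auto simp: pos_le_divide_eq min_def)
    qed (use assms in auto)
    ultimately show ?thesis by simp
  qed
  moreover have "1 / 2 ^ s \<le> (2::real) / 2 ^ s" by (intro divide_right_mono) auto
  ultimately show ?thesis by linarith
qed

lemma fn_continuous: "continuous_on {0..1} fn"
proof (rule continuous_onI)
  fix x e :: real assume x: "x \<in> {0..1}" and e: "0 < e"
  obtain s where s: "1 / 2 ^ s < e / 4"
    using real_arch_pow_inv[of "e / 4" "1/2"] e by (auto simp: power_one_over)
  obtain k where k: "real k / cells s \<le> x" "x < real (Suc k) / cells s"
    using grid_below x by auto
  have "real k / cells s \<le> 1" using k x by (meson atLeastAtMost_iff order_trans)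
  then have "k \<le> cells s" by (simp only: grid_le_1)
  have k': "real k \<le> x * cells s" "x * cells s < real k + 1"
    using k by (auto simp: pos_divide_le_eq pos_less_divide_eq)
  show "\<exists>d>0. \<forall>y\<in>{0..1}. dist y x < d \<longrightarrow> dist (fn y) (fn x) \<le> e"
  proof (intro exI[of _ "1 / cells s"] conjI ballI impI)
    fix y assume y: "y \<in> {0..1}" "dist y x < 1 / cells s"
    then have "\<bar>y - x\<bar> * cells s < 1" by (simp add: dist_real_def pos_less_divide_eq)
    then have "\<bar>y * cells s - x * cells s\<bar> < 1" by (simp add: abs_mult flip: left_diff_distrib)
    then have "\<bar>fn y - gr s k\<bar> \<le> 2 / 2 ^ s" "\<bar>fn x - gr s k\<bar> \<le> 2 / 2 ^ s"
      using x y k' \<open>k \<le> cells s\<close> by (auto intro!: fn_approx)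
    then have "\<bar>fn y - fn x\<bar> \<le> 4 * (1 / 2 ^ s)" by simp
    then show "dist (fn y) (fn x) \<le> e" using s by (simp add: dist_real_def)
  qed simp
qed

lemma fn_image: "fn ` {0..1} = {0..1}"
proof
  show "fn ` {0..1} \<subseteq> {0..1}"
    using fn_mono[of 0] fn_mono[of _ 1] by (auto simp: fn_0 fn_1)
  show "{0..1} \<subseteq> fn ` {0..1}"
    using IVT'[of fn 0 _ 1] fn_continuous by (fastforce simp: fn_0 fn_1)
qed

lemma approx_cell_bounds:
  fixes s q :: nat
  defines "k \<equiv> approx_cell s q" and "r \<equiv> rational_code q * cells s"
  shows "k \<le> cells s" "k = 0 \<or> real k \<le> r" "k = cells s \<or> r \<le> real k + 1"
proof -
  let ?a = "absn (p1 q) * cells s" and ?b = "absn (p2 q)"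
  have r: "r = (if neg q then - 1 else 1) * (real ?a / real ?b)"
    by (simp add: r_def rational_code_eq)
  have "real_of_int \<lfloor>real ?a / real ?b\<rfloor> = real (?a div ?b)"
    by (simp only: floor_divide_of_nat_eq of_int_of_nat_eq)
  then have "real (?a div ?b) \<le> real ?a / real ?b" "real ?a / real ?b \<le> real (?a div ?b) + 1"
    by linarith+
  moreover have "0 \<le> real ?a / real ?b" by simp
  ultimately show "k \<le> cells s" "k = 0 \<or> real k \<le> r" "k = cells s \<or> r \<le> real k + 1"
    unfolding r k_def approx_cell_def Let_def by (auto simp del: of_nat_mult)
qed

lemma fn_computable: "computable_on {0..1} fn"
proof -
  obtain p where p: "\<And>\<phi> n. computes \<phi> p [n] (approx_value n (\<phi> (triangle (Suc n))))"
    using approx_value_program by blast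
  have "cauchy_name (\<lambda>n. approx_value n (\<phi> (triangle (Suc n)))) (fn x)"
    if x: "x \<in> {0..1}" and \<phi>: "cauchy_name \<phi> x" for x \<phi>
    unfolding cauchy_name_def
  proof
    fix n
    define q where "q = \<phi> (triangle (Suc n))"
    let ?s = "Suc n" and ?k = "approx_cell (Suc n) q"
    \<comment> \<open>Precision \<open>triangle (Suc n)\<close> is exactly the width of a cell of
      stage \<open>Suc n\<close>.\<close>
    have "\<bar>rational_code q - x\<bar> \<le> 1 / cells ?s"
      using \<phi>[unfolded cauchy_name_def, rule_format, of "triangle ?s"]
      by (simp add: q_def cells_def del: triangle_Suc)
    then have "\<bar>rational_code q - x\<bar> * cells ?s \<le> 1" by (simp add: pos_le_divide_eq)
    then have "\<bar>rational_code q * cells ?s - x * cells ?s\<bar> \<le> 1"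
      by (simp add: abs_mult flip: left_diff_distrib)
    then have "\<bar>fn x - gr ?s ?k\<bar> \<le> 2 / 2 ^ ?s"
      using approx_cell_bounds[of ?s q] by (intro fn_approx x) linarith+
    \<comment> \<open>The doubled numbers in \<open>approx_value\<close> are the codes of
      nonnegative integers.\<close>
    moreover have "rational_code (approx_value n q) = gr ?s ?k"
      by (simp add: approx_value_def rational_code_eq neg_def absn_def gr_eq_cum)
    ultimately show "\<bar>rational_code (approx_value n (\<phi> (triangle (Suc n)))) - fn x\<bar> \<le> 1 / 2 ^ n"
      by (simp add: q_def abs_minus_commute)
  qed
  with p show ?thesis unfolding computable_on_def by blast
qed

section \<open>Failure of absolute continuity\<close>

text \<open>Locking picks the least unfinished cell of stage \<open>i + 2\<close>. There is at most
  one, so the locked mass is that of a single such cell.\<close>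

lemma locks_mass_le:
  assumes "i + 2 \<le> s"
  shows "(\<Sum>k<cells s. if locks (state s) i s k then mass s k else 0) \<le> 1 / 2 ^ (i + 2)"
proof -
  let ?r = "ratio (i + 2) s" and ?fin = "finished (state s) i s"
  let ?P = "\<lambda>m. \<not> ?fin m \<and> (\<forall>l<m. ?fin l)"
  have "(\<Sum>k<cells s. if locks (state s) i s k then mass s k else 0)
      = (\<Sum>m<cells (i + 2). \<Sum>j<?r. if ?P m then mass s (m * ?r + j) else 0)"
    unfolding cells_ratio[OF assms] sum_lessThan_mult
    by (intro sum.cong refl) (simp add: locks_def ratio_def[symmetric] del: add_2_eq_Suc')
  also have "\<dots> = (\<Sum>m<cells (i + 2). if ?P m then mass (i + 2) m else 0)"
  proof (intro sum.cong refl)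
    fix m assume "m \<in> {..<cells (i + 2)}"
    moreover have "(\<Sum>j<n. if B then g j else 0) = (if B then sum g {..<n} else 0)"
      for B n and g :: "nat \<Rightarrow> real" by simp
    ultimately show "(\<Sum>j<?r. if ?P m then mass s (m * ?r + j) else 0)
        = (if ?P m then mass (i + 2) m else 0)"
      using mass_desc[OF assms, of m] by (simp only: lessThan_iff)
  qed
  also have "\<dots> \<le> 1 / 2 ^ (i + 2)"
  proof (cases "\<exists>m<cells (i + 2). ?P m")
    case True
    then obtain m where m: "m < cells (i + 2)" "?P m" by blast
    have uniq: "?P l \<longleftrightarrow> l = m" for l using m(2) by (metis linorder_neqE_nat)
    have "(\<Sum>l<cells (i + 2). if ?P l then mass (i + 2) l else 0) = mass (i + 2) m"
      unfolding uniq using m(1) by simp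
    then show ?thesis using mass_le[OF m(1)] by simp
  next
    case False
    then have "(\<Sum>l<cells (i + 2). if ?P l then mass (i + 2) l else 0) = 0"
      by (intro sum.neutral) auto
    then show ?thesis by simp
  qed
  finally show ?thesis .
qed

lemma locked_mass_le: "(\<Sum>k<cells s. if locked (state s) s k then mass s k else 0) \<le> 1 / 2"
proof -
  have "(\<Sum>k<cells s. if locked (state s) s k then mass s k else 0)
      \<le> (\<Sum>k<cells s. \<Sum>i<s - 1. if locks (state s) i s k then mass s k else 0)"
  proof (rule sum_mono)
    fix k assume "k \<in> {..<cells s}"
    then have nonneg: "0 \<le> mass s k" using mass_pos by (simp add: less_imp_le)
    show "(if locked (state s) s k then mass s k else 0)
        \<le> (\<Sum>i<s - 1. if locks (state s) i s k then mass s k else 0)"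
    proof (cases "locked (state s) s k")
      case True
      then obtain i where i: "i < s - 1" "locks (state s) i s k" unfolding locked_def by blast
      then have "mass s k = (if locks (state s) i s k then mass s k else 0)" by simp
      also have "\<dots> \<le> (\<Sum>i<s - 1. if locks (state s) i s k then mass s k else 0)"
        using i(1) nonneg by (intro member_le_sum) auto
      finally show ?thesis using True by simp
    qed (simp add: sum_nonneg nonneg)
  qed
  also have "\<dots> = (\<Sum>i<s - 1. \<Sum>k<cells s. if locks (state s) i s k then mass s k else 0)"
    by (rule sum.swap)
  also have "\<dots> \<le> (\<Sum>i<s - 1. 1 / 2 ^ (i + 2))"
    by (intro sum_mono locks_mass_le) auto
  also have "\<dots> \<le> 1 / 2"
  proof -
    have "(\<Sum>i<n. 1 / 2 ^ (i + 2)) = 1 / 2 - 1 / (2 * 2 ^ n :: real)" for n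
      by (induction n) (simp_all add: field_simps)
    then show ?thesis by simp
  qed
  finally show ?thesis .
qed

lemma sum_mass: "(\<Sum>k<cells s. mass s k) = 1"
  using gr_cells[of s] by (simp add: gr_def)

text \<open>At most half of the mass is locked. Of the rest at least half ends up in the first
  pieces of the halves, as \<open>4 ^ s \<le> 2 * (4 ^ s - 2 ^ s + 1)\<close>. The index m numbers
  the halves.\<close>

lemma concentrated_mass:
  assumes "1 \<le> s"
  shows "1 / 4 \<le> (\<Sum>m<2 * cells s. mass (Suc s) (m * 2 ^ s))"
proof -
  have "(if locked (state s) s k then 0 else mass s k / 2)
      \<le> (\<Sum>l<2. mass (Suc s) ((k * 2 + l) * 2 ^ s))" if k: "k < cells s" for k
  proof (cases "locked (state s) s k")
    case True
    have "(k * 2 + l) * 2 ^ s < cells (Suc s)" if "l < 2" for l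
    proof -
      have "(k * 2 + l) * 2 ^ s < (cells s * 2) * 2 ^ s" using k that by simp
      then show ?thesis by (simp add: cells_Suc)
    qed
    then have "0 \<le> mass (Suc s) ((k * 2 + l) * 2 ^ s)" if "l < 2" for l
      using that mass_pos by (simp add: less_imp_le)
    then show ?thesis using True by (auto intro!: sum_nonneg)
  next
    case False
    have "mass s k / 4 \<le> mass (Suc s) ((k * 2 + l) * 2 ^ s)" if l: "l < 2" for l
    proof -
      have j: "l * 2 ^ s < 2 ^ Suc s" using l by simp
      have eq: "(k * 2 + l) * 2 ^ s = k * 2 ^ Suc s + l * 2 ^ s" by (simp add: algebra_simps)
      have "(k * 2 ^ Suc s + l * 2 ^ s) div 2 ^ Suc s = k" using j by simp
      moreover have "(k * 2 ^ Suc s + l * 2 ^ s) mod 2 ^ s = 0"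
        unfolding eq[symmetric] by simp
      ultimately have f: "factor (state s) s (k * 2 ^ Suc s + l * 2 ^ s) = 4 ^ s - 2 ^ s + 1"
        using False by (simp add: factor_def)
      have double: "a \<le> 2 * (a - b + 1)" if "2 * b \<le> a" for a b :: nat using that by arith
      have "(4::nat) ^ s \<ge> 2 * 2 ^ s"
      proof -
        have "2 ^ s * 2 ^ s = (4::nat) ^ s" by (simp flip: power_mult_distrib)
        moreover have "(2::nat) ^ 1 \<le> 2 ^ s" using assms by (intro power_increasing) auto
        ultimately show ?thesis by (metis mult_le_mono1 power_one_right)
      qed
      then have "4 ^ s \<le> 2 * factor (state s) s (k * 2 ^ Suc s + l * 2 ^ s)"
        unfolding f by (rule double)
      then have "real (4 ^ s) \<le> real (2 * factor (state s) s (k * 2 ^ Suc s + l * 2 ^ s))"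
        by (simp only: of_nat_le_iff)
      then have "mass s k * (1 / 4)
          \<le> mass s k * (real (factor (state s) s (k * 2 ^ Suc s + l * 2 ^ s)) / (2 * 4 ^ s))"
        using mass_pos[OF k] by (intro mult_left_mono) (simp_all add: field_simps)
      also have "\<dots> = mass (Suc s) ((k * 2 + l) * 2 ^ s)"
        unfolding eq by (rule mass_Suc[OF k j, symmetric])
      finally show ?thesis by simp
    qed
    from this[of 0] this[of 1] show ?thesis using False by (simp add: numeral_2_eq_2)
  qed
  then have "(\<Sum>k<cells s. if locked (state s) s k then 0 else mass s k / 2)
      \<le> (\<Sum>k<cells s. \<Sum>l<2. mass (Suc s) ((k * 2 + l) * 2 ^ s))"
    by (intro sum_mono) simp
  also have "\<dots> = (\<Sum>m<cells s * 2. mass (Suc s) (m * 2 ^ s))"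
    by (simp only: sum_lessThan_mult)
  also have "cells s * 2 = 2 * cells s" by simp
  finally have "(\<Sum>k<cells s. if locked (state s) s k then 0 else mass s k / 2)
      \<le> (\<Sum>m<2 * cells s. mass (Suc s) (m * 2 ^ s))" .
  moreover have "(\<Sum>k<cells s. if locked (state s) s k then 0 else mass s k / 2)
      = ((\<Sum>k<cells s. mass s k) - (\<Sum>k<cells s. if locked (state s) s k then mass s k else 0)) / 2"
    unfolding sum_subtractf[symmetric] sum_divide_distrib by (intro sum.cong) auto
  ultimately show ?thesis using locked_mass_le[of s] by (simp add: sum_mass)
qed

text \<open>The first pieces of all halves have total length \<open>1 / 2 ^ s\<close> but carry mass
  at least 1/4, so no \<open>\<delta>\<close> works for \<open>\<epsilon> = 1 / 4\<close>.\<close>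

lemma fn_not_absolutely_continuous: "\<not> absolutely_continuous_fun_on {0..1} fn"
proof
  assume "absolutely_continuous_fun_on {0..1} fn"
  then obtain \<delta> where \<delta>: "0 < \<delta>" and ac: "\<And>P. finite P \<Longrightarrow> (\<forall>(a, b)\<in>P. a < b \<and> {a..b} \<subseteq> {0..1}) \<Longrightarrow>
      disjoint_family_on (\<lambda>(a, b). {a<..<b}) P \<Longrightarrow> (\<Sum>(a, b)\<in>P. b - a) < \<delta> \<Longrightarrow>
      (\<Sum>(a, b)\<in>P. \<bar>fn b - fn a\<bar>) < 1 / 4"
    unfolding absolutely_continuous_fun_on_def
    by (elim allE[of _ "1 / 4"]) auto
  obtain n where n: "1 / 2 ^ n < \<delta>"
    using real_arch_pow_inv[of \<delta> "1/2"] \<delta> by (auto simp: power_one_over)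
  define s where "s = Suc n"
  let ?c = "real (cells (Suc s))"
  define I where "I = (\<lambda>m::nat. (real (m * 2 ^ s) / ?c, real (Suc (m * 2 ^ s)) / ?c))"
  let ?P = "I ` {..<2 * cells s}"
  have c: "cells (Suc s) = 2 * cells s * 2 ^ s" by (simp add: cells_Suc)
  have inj: "inj_on I {..<2 * cells s}"
    by (rule inj_onI) (simp add: I_def)
  have less: "m * 2 ^ s < cells (Suc s)" if "m < 2 * cells s" for m
    using that by (simp add: c)
  have "(\<Sum>(a, b)\<in>?P. \<bar>fn b - fn a\<bar>) < 1 / 4"
  proof (rule ac)
    show "\<forall>(a, b)\<in>?P. a < b \<and> {a..b} \<subseteq> {0..1}"
    proof safe
      fix a b m assume ab: "(a, b) = I m" and m: "m < 2 * cells s"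
      show "a < b" using ab by (simp add: I_def divide_strict_right_mono)
      fix x assume x: "x \<in> {a..b}"
      have "real (Suc (m * 2 ^ s)) / ?c \<le> 1" unfolding grid_le_1 using less[OF m] by simp
      then have "b \<le> 1" using ab by (simp add: I_def)
      moreover have "0 \<le> a" using ab by (simp add: I_def)
      ultimately show "x \<in> {0..1}" using x by auto
    qed
    let ?J = "\<lambda>(a, b). {a<..<b :: real}"
    have *: "?J (I m) \<inter> ?J (I l) = {}" if "m < l" for m l
    proof -
      have "Suc (m * 2 ^ s) \<le> Suc m * 2 ^ s" by simp
      also have "\<dots> \<le> l * 2 ^ s" using that by (intro mult_le_mono1) simp
      finally have "real (Suc (m * 2 ^ s)) / ?c \<le> real (l * 2 ^ s) / ?c"
        by (intro divide_right_mono) (simp_all only: of_nat_le_iff of_nat_0_le_iff)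
      then show ?thesis unfolding I_def prod.case by fastforce
    qed
    have "?J (I m) \<inter> ?J (I l) = {}" if "I m \<noteq> I l" for m l
      using *[of m l] *[of l m] that by (cases m l rule: linorder_cases) (auto simp only: Int_commute)
    then show "disjoint_family_on ?J ?P"
      unfolding disjoint_family_on_def by (metis (no_types, lifting) imageE)
    have "(\<Sum>(a, b)\<in>?P. b - a) = (\<Sum>m<2 * cells s. 1 / ?c)"
      unfolding sum.reindex[OF inj] by (intro sum.cong) (auto simp: I_def simp flip: diff_divide_distrib)
    also have "\<dots> = 1 / 2 ^ s" unfolding c by simp
    also have "\<dots> \<le> 1 / 2 ^ n" by (simp add: s_def field_simps)
    finally show "(\<Sum>(a, b)\<in>?P. b - a) < \<delta>" using n by linarith
  qed simp
  moreover have "(\<Sum>(a, b)\<in>?P. \<bar>fn b - fn a\<bar>) = (\<Sum>m<2 * cells s. mass (Suc s) (m * 2 ^ s))"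
    unfolding sum.reindex[OF inj]
  proof (intro sum.cong refl)
    fix m assume "m \<in> {..<2 * cells s}"
    then have "m * 2 ^ s < cells (Suc s)" using less by simp
    then show "((\<lambda>(a, b). \<bar>fn b - fn a\<bar>) \<circ> I) m = mass (Suc s) (m * 2 ^ s)"
      using mass_pos[of "m * 2 ^ s" "Suc s"] by (simp only: I_def comp_apply prod.case fn_grid gr_Suc) simp
  qed
  ultimately show False using concentrated_mass[of s] by (simp add: s_def)
qed

section \<open>Images of effectively closed null sets\<close>

lemma interval_code_eq: "interval_code n = {rational_code (p1 n)<..<rational_code (p2 n)}"
  by (simp add: interval_code_def p1_def p2_def split_beta)

text \<open>Ensures that the default output of \<open>uenum\<close> contributes no points.\<close>

lemma interval_code_0: "interval_code 0 = {}"
proof -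
  have "prod_decode 0 = (0, 0)"
    by (simp add: prod_decode_def prod_decode_aux.simps)
  then show ?thesis by (simp add: interval_code_def)
qed

lemma removed_iff:
  "removed e s k \<longleftrightarrow> (\<exists>t<s. {real k / cells s..real (Suc k) / cells s} \<subseteq> interval_code (uenum e t))"
proof -
  have "real k / cells s \<le> real (Suc k) / cells s" by (intro divide_right_mono) auto
  then have "{real k / cells s..real (Suc k) / cells s} \<subseteq> interval_code (uenum e t)
      \<longleftrightarrow> rational_code (p1 (uenum e t)) < real k / cells s
        \<and> real (Suc k) / cells s < rational_code (p2 (uenum e t))" for t
    unfolding interval_code_eq subset_iff by (force simp del: of_nat_Suc)
  then show ?thesis
    by (simp only: removed_def code_less_iff code_greater_iff cells_pos)
qed

lemma grid_refine:
  assumes "j < 2 ^ Suc s"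
  shows "real k / cells s \<le> real (k * 2 ^ Suc s + j) / cells (Suc s)"
    "real (Suc (k * 2 ^ Suc s + j)) / cells (Suc s) \<le> real (Suc k) / cells s"
proof -
  let ?q = "2 ^ Suc s :: nat"
  have c: "real (cells (Suc s)) = real (cells s) * real ?q" by (simp add: cells_Suc)
  have grid: "real (l * ?q) / cells (Suc s) = real l / cells s" for l
    unfolding c of_nat_mult by simp
  show "real k / cells s \<le> real (k * ?q + j) / cells (Suc s)"
    unfolding grid[of k, symmetric]
    by (intro divide_right_mono) (simp_all only: of_nat_le_iff of_nat_0_le_iff le_add1)
  have "Suc (k * ?q + j) \<le> Suc k * ?q" using assms by simp
  then show "real (Suc (k * ?q + j)) / cells (Suc s) \<le> real (Suc k) / cells s"
    unfolding grid[of "Suc k", symmetric]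
    by (intro divide_right_mono) (simp_all only: of_nat_le_iff of_nat_0_le_iff)
qed

lemma removed_Suc:
  assumes "removed e s k" "j < 2 ^ Suc s"
  shows "removed e (Suc s) (k * 2 ^ Suc s + j)"
proof -
  have "{real (k * 2 ^ Suc s + j) / cells (Suc s)..real (Suc (k * 2 ^ Suc s + j)) / cells (Suc s)}
      \<subseteq> {real k / cells s..real (Suc k) / cells s}"
    using grid_refine[OF assms(2), of k] by (intro atLeastatMost_subset_iff[THEN iffD2]) blast
  moreover obtain t where "t < s" "{real k / cells s..real (Suc k) / cells s} \<subseteq> interval_code (uenum e t)"
    using assms(1) unfolding removed_iff by blast
  ultimately show ?thesis unfolding removed_iff by (intro exI[of _ t]) auto
qed

section \<open>Mass not yet removed\<close>

definition rem_mass :: "nat \<Rightarrow> nat \<Rightarrow> nat \<Rightarrow> real" where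
  "rem_mass e s k = (if removed e s k then 0 else mass s k)"

definition rest :: "nat \<Rightarrow> nat \<Rightarrow> nat \<Rightarrow> real" where
  "rest i s m = (\<Sum>j<ratio (i + 2) s. rem_mass (p1 i) s (m * ratio (i + 2) s + j))"

lemma finished_iff:
  assumes "i + 2 \<le> s" "m < cells (i + 2)"
  shows "finished (state s) i s m \<longleftrightarrow> rest i s m * 2 ^ i \<le> mass (i + 2) m"
proof -
  let ?r = "ratio (i + 2) s" and ?t = "real (total s)"
  let ?f = "\<lambda>j. if removed (p1 i) s (m * ?r + j) then 0 else weight s (m * ?r + j)"
  have rest: "rest i s m = real (\<Sum>j<?r. ?f j) / ?t"
    unfolding rest_def of_nat_sum sum_divide_distrib
    by (intro sum.cong) (auto simp: rem_mass_def mass_def)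
  have mass: "mass (i + 2) m = real (\<Sum>j<?r. weight s (m * ?r + j)) / ?t"
    unfolding mass_desc[OF assms, symmetric] of_nat_sum sum_divide_distrib by (simp add: mass_def)
  have "finished (state s) i s m
      \<longleftrightarrow> (\<Sum>j<?r. ?f j) * 2 ^ i \<le> (\<Sum>j<?r. weight s (m * ?r + j))"
    unfolding finished_def Let_def ratio_def[symmetric] weight_def[symmetric] ..
  also have "\<dots> \<longleftrightarrow> real (\<Sum>j<?r. ?f j) * 2 ^ i \<le> real (\<Sum>j<?r. weight s (m * ?r + j))"
    by (simp only: of_nat_le_iff[where 'a=real, symmetric] of_nat_mult of_nat_power of_nat_numeral)
  also have "\<dots> \<longleftrightarrow> rest i s m * 2 ^ i \<le> mass (i + 2) m"
    unfolding rest mass times_divide_eq_left by (simp only: divide_le_cancel) simp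
  finally show ?thesis .
qed

lemma rem_mass_block:
  assumes "k < cells s"
  shows "(\<Sum>j<2 ^ Suc s. rem_mass e (Suc s) (k * 2 ^ Suc s + j)) \<le> rem_mass e s k"
proof (cases "removed e s k")
  case True
  then have "(\<Sum>j<2 ^ Suc s. rem_mass e (Suc s) (k * 2 ^ Suc s + j)) = 0"
    using removed_Suc[OF True] by (intro sum.neutral) (simp only: rem_mass_def lessThan_iff, simp)
  then show ?thesis using True by (simp only: rem_mass_def) simp
next
  case False
  have "k * 2 ^ Suc s + j < cells (Suc s)" if "j < 2 ^ Suc s" for j
    using ratio_cell_less[of s "Suc s" k j] assms that by (simp add: ratio_Suc)
  then have "(\<Sum>j<2 ^ Suc s. rem_mass e (Suc s) (k * 2 ^ Suc s + j))
      \<le> (\<Sum>j<2 ^ Suc s. mass (Suc s) (k * 2 ^ Suc s + j))"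
    using mass_pos by (intro sum_mono) (simp add: rem_mass_def less_imp_le)
  then show ?thesis using mass_block[OF assms] False by (simp add: rem_mass_def)
qed

lemma rest_Suc:
  assumes "i + 2 \<le> s" "m < cells (i + 2)"
  shows "rest i (Suc s) m \<le> rest i s m"
proof -
  let ?r = "ratio (i + 2) s"
  have "rest i (Suc s) m
      = (\<Sum>l<?r. \<Sum>j<2 ^ Suc s. rem_mass (p1 i) (Suc s) ((m * ?r + l) * 2 ^ Suc s + j))"
    unfolding rest_def ratio_Suc[OF assms(1)] sum_lessThan_mult by (simp add: algebra_simps)
  also have "\<dots> \<le> (\<Sum>l<?r. rem_mass (p1 i) s (m * ?r + l))"
    using assms by (intro sum_mono rem_mass_block ratio_cell_less) auto
  finally show ?thesis by (simp add: rest_def)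
qed

text \<open>The threshold is fixed, since later stages preserve the mass of the cell m, and the
  unremoved mass only shrinks, whatever the other requirements do.\<close>

lemma finished_mono:
  assumes "i + 2 \<le> s" "m < cells (i + 2)" "s \<le> t" "finished (state s) i s m"
  shows "finished (state t) i t m"
  using assms(3,4)
proof (induction rule: dec_induct)
  case (step n)
  then have "i + 2 \<le> n" using assms(1) by simp
  moreover have "rest i (Suc n) m * 2 ^ i \<le> rest i n m * 2 ^ i"
    using rest_Suc[OF \<open>i + 2 \<le> n\<close> assms(2)] by (intro mult_right_mono) auto
  ultimately show ?case using step finished_iff[OF _ assms(2)] by (meson le_SucI order_trans)
qed

section \<open>Lebesgue measure of the part not yet removed\<close>

definition cell :: "nat \<Rightarrow> nat \<Rightarrow> real set" where
  "cell s k = {real k / cells s..<real (Suc k) / cells s}"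

definition uncovered :: "nat \<Rightarrow> nat \<Rightarrow> real set" where
  "uncovered e s = (\<Union>k\<in>{k. k < cells s \<and> \<not> removed e s k}. cell s k)"

lemma cell_Suc:
  assumes "j < 2 ^ Suc s"
  shows "cell (Suc s) (k * 2 ^ Suc s + j) \<subseteq> cell s k"
  unfolding cell_def using grid_refine[OF assms, of k] by (intro ivl_subset[THEN iffD2]) blast

lemma uncovered_Suc: "uncovered e (Suc s) \<subseteq> uncovered e s"
proof
  fix x assume "x \<in> uncovered e (Suc s)"
  then obtain k where k: "k < cells (Suc s)" "\<not> removed e (Suc s) k" "x \<in> cell (Suc s) k"
    unfolding uncovered_def by blast
  from k(1) obtain l j where l: "k = l * 2 ^ Suc s + j" "l < cells s" "j < 2 ^ Suc s"
    by (rule cell_split)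
  then have "\<not> removed e s l" "x \<in> cell s l"
    using k(2,3) removed_Suc cell_Suc by blast+
  then show "x \<in> uncovered e s" using l(2) unfolding uncovered_def by blast
qed

text \<open>Cells are half-open for this reason: their lengths add up. In return
  \<open>uncovered\<close> never contains the point 1, which does not affect measures.\<close>

lemma disjoint_cells: "disjoint_family_on (cell s) I"
proof -
  have *: "cell s k \<inter> cell s l = {}" if "k < l" for k l
  proof -
    have "real (Suc k) / cells s \<le> real l / cells s" using that by (intro divide_right_mono) auto
    then show ?thesis unfolding cell_def by fastforce
  qed
  have "cell s k \<inter> cell s l = {}" if "k \<noteq> l" for k l
    using *[of k l] *[of l k] that by (cases k l rule: linorder_cases) (auto simp only: Int_commute)
  then show ?thesis unfolding disjoint_family_on_def by blast
qed

lemma measure_cell: "emeasure lebesgue (cell s k) = ennreal (1 / cells s)"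
proof -
  have le: "real k / cells s \<le> real (Suc k) / cells s" by (intro divide_right_mono) auto
  have "emeasure lebesgue (cell s k) = emeasure lborel (cell s k)"
    by (simp add: cell_def)
  also have "\<dots> = ennreal (real (Suc k) / cells s - real k / cells s)"
    unfolding cell_def using le by (rule emeasure_lborel_Ico)
  also have "real (Suc k) / cells s - real k / cells s = 1 / cells s"
    by (simp flip: diff_divide_distrib)
  finally show ?thesis .
qed

lemma measure_uncovered:
  "uncovered e s \<in> sets lebesgue" "emeasure lebesgue (uncovered e s) \<noteq> \<infinity>"
  "measure lebesgue (uncovered e s) = card {k. k < cells s \<and> \<not> removed e s k} / cells s"
proof -
  let ?I = "{k. k < cells s \<and> \<not> removed e s k}"
  have sets: "cell s k \<in> sets lebesgue" for k by (simp add: cell_def)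
  then show "uncovered e s \<in> sets lebesgue" unfolding uncovered_def by (intro sets.finite_UN) auto
  have "emeasure lebesgue (uncovered e s) = (\<Sum>k\<in>?I. emeasure lebesgue (cell s k))"
    unfolding uncovered_def using sets
    by (intro sum_emeasure[symmetric] disjoint_cells) auto
  also have "\<dots> = ennreal (card ?I / cells s)"
    by (simp add: measure_cell ennreal_of_nat_eq_real_of_nat flip: ennreal_mult)
  finally have em: "emeasure lebesgue (uncovered e s) = ennreal (card ?I / cells s)" .
  then show "emeasure lebesgue (uncovered e s) \<noteq> \<infinity>" by simp
  show "measure lebesgue (uncovered e s) = card ?I / cells s"
    by (simp add: measure_def em)
qed

text \<open>A point outside A lies in some enumerated interval, and a cell around it that is shorter
  than its distance to both ends gets removed.\<close>

lemma uncovered_Inter_subset: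
  assumes "- A = (\<Union>n. interval_code (g n))" "\<And>n. \<exists>t. uenum e t = g n"
  shows "(\<Inter>s. uncovered e s) \<subseteq> A"
proof
  fix x assume x: "x \<in> (\<Inter>s. uncovered e s)"
  show "x \<in> A"
  proof (rule ccontr)
    assume "x \<notin> A"
    then obtain n where "x \<in> interval_code (g n)" using assms(1) by blast
    moreover obtain t where t: "uenum e t = g n" using assms(2) by blast
    ultimately obtain a b where ab: "interval_code (uenum e t) = {a<..<b}" "a < x" "x < b"
      by (auto simp: interval_code_eq)
    \<comment> \<open>The stage must also lie beyond t, since \<open>removed\<close> inspects only
      indices below s.\<close>
    obtain s where s: "Suc t \<le> s" "1 / real (cells s) < min (x - a) (b - x)"
      using cells_large[of "min (x - a) (b - x)" "Suc t"] ab by auto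
    obtain k where k: "\<not> removed e s k" "x \<in> cell s k"
      using x unfolding uncovered_def by blast
    have "real (Suc k) / cells s = real k / cells s + 1 / cells s"
      by (simp add: add_divide_distrib)
    then have "{real k / cells s..real (Suc k) / cells s} \<subseteq> {a<..<b}"
      using s(2) k(2) unfolding cell_def by auto
    then show False using k(1) s(1) ab(1) unfolding removed_iff by (metis Suc_le_lessD)
  qed
qed

text \<open>Continuity from above; the intersection is contained in the null set A.\<close>

lemma measure_uncovered_tendsto:
  assumes "- A = (\<Union>n. interval_code (g n))" "\<And>n. \<exists>t. uenum e t = g n" "A \<in> null_sets lebesgue"
  shows "(\<lambda>s. measure lebesgue (uncovered e s)) \<longlonglongrightarrow> 0"
proof -
  have "(\<lambda>s. measure lebesgue (uncovered e s)) \<longlonglongrightarrow> measure lebesgue (\<Inter>s. uncovered e s)"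
    using measure_uncovered uncovered_Suc
    by (intro Lim_measure_decseq decseq_SucI) auto
  moreover have "(\<Inter>s. uncovered e s) \<in> null_sets lebesgue"
    using assms(3) uncovered_Inter_subset[OF assms(1,2)] measure_uncovered(1)
    by (intro null_sets_subset[OF assms(3)]) auto
  ultimately show ?thesis by (simp add: null_sets_def measure_def)
qed

text \<open>While a cell stays locked, the density on it does not grow.\<close>

lemma locked_density:
  assumes "i + 2 \<le> s0" "m < cells (i + 2)"
    and lock: "\<And>s. s0 \<le> s \<Longrightarrow> \<not> finished (state s) i s m \<and> (\<forall>l<m. finished (state s) i s l)"
    and "s0 \<le> s" "j < ratio (i + 2) s"
  shows "mass s (m * ratio (i + 2) s + j) \<le> real (cells s0) / real (cells s)"
  using assms(4,5)
proof (induction arbitrary: j rule: dec_induct)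
  case base
  have "m * ratio (i + 2) s0 + j < cells s0" using assms(1,2) base by (intro ratio_cell_less)
  then have "mass s0 (m * ratio (i + 2) s0 + j) \<le> 1 / 2 ^ s0" by (rule mass_le)
  also have "\<dots> \<le> 1" by simp
  finally show ?case by simp
next
  case (step s)
  let ?r = "ratio (i + 2) s"
  have ile: "i + 2 \<le> s" using assms(1) step.hyps by simp
  define l h where "l = j div 2 ^ Suc s" and "h = j mod 2 ^ Suc s"
  have h: "h < 2 ^ Suc s" by (simp add: h_def)
  have l: "l < ?r"
    using step.prems unfolding ratio_Suc[OF ile] l_def by (rule less_mult_imp_div_less)
  have k: "m * ?r + l < cells s" using ile assms(2) l by (rule ratio_cell_less)
  have "j = l * 2 ^ Suc s + h" unfolding l_def h_def by (rule div_mult_mod_eq[symmetric])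
  then have "m * ratio (i + 2) (Suc s) + j = (m * ?r + l) * 2 ^ Suc s + h"
    by (simp only: ratio_Suc[OF ile] add_mult_distrib mult.assoc add.assoc)
  moreover have "locked (state s) s (m * ?r + l)"
    unfolding locked_def
  proof (intro exI conjI)
    show "i < s - 1" using ile by simp
    show "locks (state s) i s (m * ?r + l)"
      using lock[OF step.hyps(1)] l unfolding locks_def Let_def ratio_def[symmetric] by simp
  qed
  then have "factor (state s) s ((m * ?r + l) * 2 ^ Suc s + h) = 2 ^ s"
    using h by (simp add: factor_def)
  ultimately have "mass (Suc s) (m * ratio (i + 2) (Suc s) + j) = mass s (m * ?r + l) * (2 ^ s / (2 * 4 ^ s))"
    using mass_Suc[OF k h] by simp
  \<comment> \<open>Each of the \<open>2 ^ Suc s\<close> parts gets an equal share, so the ratio of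
    mass to length is unchanged.\<close>
  also have "(2 ^ s / (2 * 4 ^ s) :: real) = 1 / 2 ^ Suc s"
  proof -
    have "(4 :: real) ^ s = 2 ^ s * 2 ^ s" by (simp flip: power_mult_distrib)
    then show ?thesis by simp
  qed
  also have "mass s (m * ?r + l) * (1 / 2 ^ Suc s) \<le> real (cells s0) / real (cells s) * (1 / 2 ^ Suc s)"
    by (intro mult_right_mono step.IH l) simp
  also have "\<dots> = real (cells s0) / real (cells (Suc s))" by (simp add: cells_Suc)
  finally show ?case .
qed

text \<open>Induction over the cells in the order of treatment. After all cells before m are
  finished, an m that never finishes stays locked. Its density is then bounded by
  \<open>cells s0\<close>, so its unremoved mass tends to 0 with the length, although it exceeds
  \<open>mass (i + 2) m / 2 ^ i\<close> at every stage.\<close>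

lemma eventually_finished:
  assumes A: "- A = (\<Union>n. interval_code (g n))" "\<And>n. \<exists>t. uenum (p1 i) t = g n" "A \<in> null_sets lebesgue"
    and "m < cells (i + 2)"
  shows "\<exists>s\<ge>i + 2. finished (state s) i s m"
  using \<open>m < cells (i + 2)\<close>
proof (induction m rule: less_induct)
  case (less m)
  note m = less.prems
  show ?case
  proof (rule ccontr)
    assume never: "\<not> ?case"
    have "\<exists>h. \<forall>l<m. h l \<ge> i + 2 \<and> finished (state (h l)) i (h l) l"
      using less by (intro choice) (meson less_trans)
    then obtain h where h: "\<And>l. l < m \<Longrightarrow> h l \<ge> i + 2 \<and> finished (state (h l)) i (h l) l" by blast
    define s0 where "s0 = Max (insert (i + 2) (h ` {..<m}))"
    have s0: "i + 2 \<le> s0" "\<And>l. l < m \<Longrightarrow> h l \<le> s0" by (auto simp: s0_def)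
    have lock: "\<not> finished (state s) i s m \<and> (\<forall>l<m. finished (state s) i s l)" if "s0 \<le> s" for s
    proof (intro conjI allI impI)
      show "\<not> finished (state s) i s m" using never s0(1) that order_trans by blast
      fix l assume l: "l < m"
      show "finished (state s) i s l"
        using h[OF l] s0(2)[OF l] l m that by (intro finished_mono[of i "h l" l s]) auto
    qed
    have bound: "mass (i + 2) m / 2 ^ i \<le> real (cells s0) * measure lebesgue (uncovered (p1 i) s)"
      if s: "s0 \<le> s" for s
    proof -
      let ?r = "ratio (i + 2) s" and ?e = "p1 i"
      have ile: "i + 2 \<le> s" using s0(1) s by simp
      let ?I = "{k. k < cells s \<and> \<not> removed ?e s k}" and ?J = "{j. j < ?r \<and> \<not> removed ?e s (m * ?r + j)}"
      have "rest i s m = (\<Sum>j\<in>?J. mass s (m * ?r + j))"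
        unfolding rest_def rem_mass_def by (intro sum.mono_neutral_cong_right) auto
      also have "\<dots> \<le> (\<Sum>j\<in>?J. real (cells s0) / real (cells s))"
        using locked_density[OF s0(1) m lock s] by (intro sum_mono) auto
      also have "\<dots> = real (card ?J) * (real (cells s0) / real (cells s))" by simp
      also have "card ?J \<le> card ?I"
        using ratio_cell_less[OF ile m] by (intro card_inj_on_le[of "\<lambda>j. m * ?r + j"]) (auto simp: inj_on_def)
      then have "real (card ?J) * (real (cells s0) / real (cells s))
          \<le> real (card ?I) * (real (cells s0) / real (cells s))"
        by (intro mult_right_mono) auto
      also have "\<dots> = real (cells s0) * measure lebesgue (uncovered ?e s)"
        unfolding measure_uncovered(3) by simp
      finally have "rest i s m \<le> real (cells s0) * measure lebesgue (uncovered ?e s)" .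
      moreover have "mass (i + 2) m < rest i s m * 2 ^ i"
        using lock[OF s] finished_iff[OF ile m] by simp
      ultimately show ?thesis by (simp add: pos_divide_le_eq) (smt (verit) mult_right_mono zero_le_power)
    qed
    have "(\<lambda>s. real (cells s0) * measure lebesgue (uncovered (p1 i) s)) \<longlonglongrightarrow> real (cells s0) * 0"
      using measure_uncovered_tendsto[OF A] by (rule tendsto_mult_left)
    then have "mass (i + 2) m / 2 ^ i \<le> real (cells s0) * 0"
      by (rule tendsto_lowerbound[OF _ eventually_sequentiallyI[OF bound]]) simp_all
    moreover have "0 < mass (i + 2) m / 2 ^ i" using mass_pos[OF m] by (rule divide_pos_pos) simp
    ultimately show False by simp
  qed
qed

text \<open>A removed cell lies in an interval disjoint from A, so each point of A lies in a closed
  cell that is not removed, and its value lies between the grid values at the ends.\<close>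

lemma image_cover:
  assumes A: "- A = (\<Union>n. interval_code (g n))" "\<And>t. uenum e t \<in> insert 0 (range g)" "A \<subseteq> {0..1}"
  shows "fn ` A \<subseteq> (\<Union>k\<in>{k. k < cells s \<and> \<not> removed e s k}. {gr s k..gr s (Suc k)})"
proof
  fix y assume "y \<in> fn ` A"
  then obtain x where x: "x \<in> A" "y = fn x" by blast
  then have x01: "0 \<le> x" "x \<le> 1" using A(3) by auto
  obtain k where k: "k < cells s" "real k / cells s \<le> x" "x \<le> real (Suc k) / cells s"
  \<comment> \<open>The point 1 belongs to the last closed cell.\<close>
  proof (cases "x = 1")
    case True
    then show ?thesis using that[of "cells s - 1"] by (simp add: pos_divide_le_eq)
  next
    case False
    obtain k where k: "real k / cells s \<le> x" "x < real (Suc k) / cells s"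
      using grid_below x01 by blast
    then have "real k / cells s < 1" using False x01 by linarith
    then have "k < cells s" by (simp add: pos_divide_less_eq)
    then show ?thesis using k that by simp
  qed
  have "\<not> removed e s k"
  proof
    assume "removed e s k"
    then obtain t where "x \<in> interval_code (uenum e t)"
      using k unfolding removed_iff by (meson atLeastAtMost_iff subsetD)
    then have "x \<in> (\<Union>n. interval_code (g n))"
      using A(2)[of t] by (auto simp: interval_code_0)
    then show False using x(1) A(1) by blast
  qed
  moreover have "fn x \<in> {gr s k..gr s (Suc k)}"
    using k x01 by (auto intro: fn_lower fn_upper)
  ultimately show "y \<in> (\<Union>k\<in>{k. k < cells s \<and> \<not> removed e s k}. {gr s k..gr s (Suc k)})"
    using k(1) x(2) by blast
qed

lemma image_null:
  assumes "A \<subseteq> {0..1}" "Pi01_set A" "A \<in> null_sets lebesgue"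
  shows "fn ` A \<in> null_sets lebesgue"
proof -
  obtain g where g: "computable_seq g" "- A = (\<Union>n. interval_code (g n))"
    using assms(2) unfolding Pi01_set_def by blast
  obtain e where e: "\<And>t. uenum e t \<in> insert 0 (range g)" "\<And>n. \<exists>t. uenum e t = g n"
    using uenum_enumerates[OF g(1)] by blast
  have "negligible (fn ` A)"
    unfolding negligible_outer
  proof (intro allI impI)
    fix \<epsilon> :: real assume "0 < \<epsilon>"
    then obtain j where j: "1 / 2 ^ j < \<epsilon>"
      using real_arch_pow_inv[of \<epsilon> "1/2"] by (auto simp: power_one_over)
    \<comment> \<open>A requirement for the set with index e whose number is at least j, so that its
      bound \<open>1 / 2 ^ i\<close> is below \<open>\<epsilon>\<close>.\<close>
    define i where "i = pr e j"
    have i: "p1 i = e" "j \<le> i" by (simp_all add: i_def) (simp add: pr_def le_prod_encode_2)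
    have "\<exists>s. \<forall>m<cells (i + 2). i + 2 \<le> s m \<and> finished (state (s m)) i (s m) m"
      using eventually_finished[OF g(2), of i] e(2) assms(3) i(1) by (intro choice) auto
    then obtain h where h: "\<And>m. m < cells (i + 2) \<Longrightarrow> i + 2 \<le> h m \<and> finished (state (h m)) i (h m) m"
      by blast
    \<comment> \<open>A stage by which requirement i has finished all of its cells.\<close>
    define s where "s = Max (insert (i + 2) (h ` {..<cells (i + 2)}))"
    have ile: "i + 2 \<le> s" and hs: "\<And>m. m < cells (i + 2) \<Longrightarrow> h m \<le> s" by (auto simp: s_def)
    have fin: "rest i s m \<le> mass (i + 2) m / 2 ^ i" if "m < cells (i + 2)" for m
      using finished_mono[of i "h m" m s] h[OF that] hs[OF that] that finished_iff[OF ile that]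
      by (simp add: pos_le_divide_eq)
    let ?I = "{k. k < cells s \<and> \<not> removed e s k}"
    let ?T = "\<Union>k\<in>?I. {gr s k..gr s (Suc k)}"
    have "measure lebesgue ?T \<le> (\<Sum>k\<in>?I. measure lebesgue {gr s k..gr s (Suc k)})"
      by (intro measure_UNION_le) auto
    also have "\<dots> = (\<Sum>k\<in>?I. mass s k)"
      using mass_pos by (intro sum.cong) (auto simp: gr_Suc less_imp_le)
    also have "\<dots> = (\<Sum>k<cells s. rem_mass e s k)"
      unfolding rem_mass_def by (intro sum.mono_neutral_cong_left) auto
    also have "\<dots> = (\<Sum>m<cells (i + 2). rest i s m)"
      unfolding cells_ratio[OF ile] sum_lessThan_mult rest_def i(1) ..
    also have "\<dots> \<le> (\<Sum>m<cells (i + 2). mass (i + 2) m / 2 ^ i)"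
      by (intro sum_mono fin) simp
    also have "\<dots> = 1 / 2 ^ i" by (simp add: sum_mass flip: sum_divide_distrib)
    also have "\<dots> \<le> 1 / 2 ^ j" using i(2) by (intro divide_left_mono power_increasing) auto
    finally have "measure lebesgue ?T < \<epsilon>" using j by linarith
    moreover have "?T \<in> lmeasurable" by (intro fmeasurable.finite_UN) auto
    moreover have "fn ` A \<subseteq> ?T" using image_cover[OF g(2) e(1) assms(1)] .
    ultimately show "\<exists>T. fn ` A \<subseteq> T \<and> T \<in> lmeasurable \<and> measure lebesgue T < \<epsilon>" by blast
  qed
  then show ?thesis by (simp add: negligible_iff_null_sets)
qed

theorem theorem6p6:
  shows "\<exists>f :: real \<Rightarrow> real.
    strict_mono_on {0..1} f \<and>
    f ` {0..1} = {0..1} \<and>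
    computable_on {0..1} f \<and>
    \<not> absolutely_continuous_fun_on {0..1} f \<and>
    (\<forall>A. A \<subseteq> {0..1} \<and> Pi01_set A \<and> A \<in> null_sets lebesgue
       \<longrightarrow> f ` A \<in> null_sets lebesgue)"
  using fn_strict_mono fn_image fn_computable fn_not_absolutely_continuous image_null by blast

end
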